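(* Let $K,P,L\ge 1$ be integers, let $\mathcal{X}\subseteq\mathbb{R}^P$, let $\{F_0(\cdot;\psi):\psi\in\Psi_0\}$ be a family of probability distribution functions on $\mathbb{R}^K$, and let $\Phi_1,\dots,\Phi_L$ be probability distribution functions on $\mathbb{R}$. Assume: (i) (denseness condition on the expert function) for every $q\in\mathbb{R}^K$ there is a sequence $(\psi^{(n)}(q))_{n\ge1}$ in $\Psi_0$ such that $F_0(\cdot;\psi^{(n)}(q))$ converges weakly, as $n\to\infty$, to the point mass at $q$; (ii) each $\Phi_l$ ($l=1,\dots,L$) is a continuous distribution function. Then the class of mixed mixture-of-experts models $\mathcal{M}_L^{\mathrm{MMoE}}(\mathcal{X};F_0,\Phi)$ is compactly dense in the class of generalized mixed effects models $\mathcal{M}_L^{\mathrm{gen}}(\mathcal{X})$. Explicitly: let $\Theta_1,\dots,\Theta_L$ be any complete separable metric spaces, $G_l$ any probability measure on $\Theta_l$ for each $l$, and $H(\cdot\mid x,\theta)$, $x\in\mathcal{X}$, $\theta\in\Theta:=\Theta_1\times\cdots\times\Theta_L$, any family of probability distribution functions on $\mathbb{R}^K$ such that $(y,x,\theta)\mapsto H(y\mid x,\theta)$ is continuous on $\mathbb{R}^K\times\mathcal{X}\times\Theta$. Then there exists a sequence $(F^{(n)})_{n\ge 1}$ of MMoE conditional distribution functions (as defined in the context, each with its own number of components and its own parameters) such that, for every $N\in\mathbb{N}$, every $\mathbf{S}=(S_1,\dots,S_L)\in\mathbb{N}^L$, every $\mathbf{c}=(c_1,\dots,c_L)$ with $c_l:\{1,\dots,N\}\to\{1,\dots,S_l\}$,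 and every compact $\bar{\mathcal{X}}\subseteq\mathcal{X}$, $$\tilde F^{(n)}(\mathbf{y}\mid\mathbf{x})\longrightarrow\tilde H(\mathbf{y}\mid\mathbf{x})\quad\text{as } n\to\infty,$$ uniformly over $\mathbf{y}=(y_1,\dots,y_N)\in(\mathbb{R}^K)^N$ and $\mathbf{x}=(x_1,\dots,x_N)\in\bar{\mathcal{X}}^N$, where $\tilde H$ and $\tilde F^{(n)}$ are the joint distribution functions of the $N$ observations induced by $(H,G_1,\dots,G_L)$ and by $(F^{(n)},\Phi_1,\dots,\Phi_L)$ respectively. The sequence $(F^{(n)})$ does not depend on $N,\mathbf{S},\mathbf{c},\bar{\mathcal{X}}$.
   Context: **Multilevel structure.** There are $N$ observations and $L$ levels. Observation $i$ belongs at level $l$ to unit $c_l(i)\in\{1,\dots,S_l\}$. **Generalized mixed effects model.** Given $(\Theta_l,G_l)_{l=1}^L$ and $H$, the unobserved factors $\{\theta_l^{(s)}:l=1,\dots,L,\ s=1,\dots,S_l\}$ are mutually independent with $\theta_l^{(s)}\sim G_l$ on $\Theta_l$. Put $\theta_i=(\theta_1^{(c_1(i))},\dots,\theta_L^{(c_L(i))})$. Conditionally on the factors, $y_1,\dots,y_N$ are independent with $y_i\sim H(\cdot\mid x_i,\theta_i)$. The joint distribution function is $$\tilde H(\mathbf{y}\mid\mathbf{x})=\int\prod_{i=1}^N H(y_i\mid x_i,\theta_i)\ \prod_{l=1}^L\prod_{s=1}^{S_l}G_l(d\theta_l^{(s)}).$$ The class $\mathcal{M}_L^{\mathrm{gen}}(\mathcal{X})$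 consists of all such models in which every $\Theta_l$ is a complete separable metric space (with its Borel $\sigma$-algebra) and $H(y\mid x,\theta)$ is continuous in $(y,x,\theta)$. **MMoE model.** An MMoE conditional distribution function is a function of the form $$F(y\mid x,w)=\sum_{j=1}^g\pi_j(x,w)\,F_0(y;\psi_j),\qquad \pi_j(x,w)=\frac{\exp\{\alpha_{j0}+\alpha_j^{T}x+\beta_j^{T}w\}}{\sum_{j'=1}^g\exp\{\alpha_{j'0}+\alpha_{j'}^{T}x+\beta_{j'}^{T}w\}},$$ for $y\in\mathbb{R}^K$, $x\in\mathcal{X}$, $w\in\mathbb{R}^L$, where $g\in\mathbb{N}$, $\alpha_{j0}\in\mathbb{R}$, $\alpha_j\in\mathbb{R}^P$, $\beta_j\in\mathbb{R}^L$, $\psi_j\in\Psi_0$ are arbitrary. The random effects $\{w_l^{(s)}\}$ are independent real random variables with $w_l^{(s)}\sim\Phi_l$. Put $w_i=(w_1^{(c_1(i))},\dots,w_L^{(c_L(i))})$. The induced joint distribution function is $$\tilde F(\mathbf{y}\mid\mathbf{x})=\int\prod_{i=1}^N F(y_i\mid x_i,w_i)\ \prod_{l=1}^L\prod_{s=1}^{S_l}\Phi_l(dw_l^{(s)}).$$ The class $\mathcal{M}_L^{\mathrm{MMoE}}(\mathcal{X};F_0,\Phi)$ consists of all such models, with $F_0$ and $\Phi_1,\dots,\Phi_L$ fixed and $g,\alpha,\beta,\psi$ varying. **Compact denseness.** A class $\mathcal{M}_1$ of models is compactly dense in a class $\mathcal{M}_2$ if for each model in $\mathcal{M}_2$ there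 is a sequence of models in $\mathcal{M}_1$ whose joint distribution functions converge to those of the target model for all $N,\mathbf{S},\mathbf{c}$, uniformly in $(\mathbf{y},\mathbf{x})$ with all $x_i$ in $\bar{\mathcal{X}}$, for every compact $\bar{\mathcal{X}}\subseteq\mathcal{X}$. *)

theory Defs
  imports "HOL-Probability.Probability"
begin

text \<open>The order on \<^typ>\<open>real^'k\<close> is componentwise, so \<open>{..y}\<close> is the closed lower orthant at \<open>y\<close>.\<close>

definition orthant_cdf :: "(real^'k) measure \<Rightarrow> real^'k \<Rightarrow> real" where
  "orthant_cdf M y = measure M {..y}"

definition distribution_function :: "(real^'k \<Rightarrow> real) \<Rightarrow> bool" where
  "distribution_function F \<longleftrightarrow> (\<exists>M. prob_space M \<and> sets M = sets borel \<and> F = orthant_cdf M)"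

text \<open>The analogue on \<^typ>\<open>real^'k\<close> of \<^const>\<open>weak_conv\<close>, which is restricted to the real line.\<close>

definition weak_conv_vec :: "(nat \<Rightarrow> real^'k \<Rightarrow> real) \<Rightarrow> (real^'k \<Rightarrow> real) \<Rightarrow> bool" where
  "weak_conv_vec Fs F \<longleftrightarrow> (\<forall>y. isCont F y \<longrightarrow> (\<lambda>n. Fs n y) \<longlonglongrightarrow> F y)"

definition borel_of_metric :: "'a metric \<Rightarrow> 'a measure" where
  "borel_of_metric m = sigma (mspace m) {U. openin (mtopology_of m) U}"

text \<open>A model is its family of joint distribution functions, with arguments \<open>N\<close>, \<open>S\<close>, \<open>c\<close>, \<open>y\<close>, \<open>x\<close>.
  Observations are numbered \<open>1..N\<close>, the units of level \<open>l\<close> are numbered \<open>1..S l\<close>, and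
  only the values \<open>c l i\<close>, \<open>y i\<close>, \<open>x i\<close> for \<open>i \<in> {1..N}\<close> matter. The levels form the finite
  type \<^typ>\<open>'l\<close>, so \<open>L\<close> is its cardinality.\<close>

type_synonym ('l, 'y, 'x) model =
  "nat \<Rightarrow> ('l \<Rightarrow> nat) \<Rightarrow> ('l \<Rightarrow> nat \<Rightarrow> nat) \<Rightarrow> (nat \<Rightarrow> 'y) \<Rightarrow> (nat \<Rightarrow> 'x) \<Rightarrow> real"

text \<open>The integration variable \<open>t\<close> assigns to each pair \<open>(l, s)\<close> the factor of unit \<open>s\<close> at
  level \<open>l\<close>.\<close>

definition joint_df ::
  "('l::finite \<Rightarrow> 'a measure) \<Rightarrow> ('y \<Rightarrow> 'x \<Rightarrow> ('l \<Rightarrow> 'a) \<Rightarrow> real) \<Rightarrow> ('l, 'y, 'x) model" where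
  "joint_df G H N S c y x =
     (\<integral>t. (\<Prod>i\<in>{1..N}. H (y i) (x i) (\<lambda>l. t (l, c l i)))
        \<partial>(\<Pi>\<^sub>M (l, s)\<in>(SIGMA l:UNIV. {1..S l}). G l))"

text \<open>The spaces \<open>\<Theta> l\<close> are metric spaces carried by subsets of one type \<^typ>\<open>'a\<close>. As \<^typ>\<open>'a\<close>
  is arbitrary (for instance a sum type), this covers factor spaces of unrelated types.\<close>

definition gen_models ::
  "'a itself \<Rightarrow> (real^'p) set \<Rightarrow> ('l::finite, real^'k, real^'p) model set" where
  "gen_models _ X = {joint_df G H | G H (\<Theta> :: 'l \<Rightarrow> 'a metric).
     (\<forall>l. mcomplete_of (\<Theta> l) \<and> separable_space (mtopology_of (\<Theta> l))) \<and>
     (\<forall>l. prob_space (G l) \<and> sets (G l) = sets (borel_of_metric (\<Theta> l))) \<and>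
     (\<forall>x\<in>X. \<forall>\<theta>\<in>(\<Pi> l\<in>UNIV. mspace (\<Theta> l)). distribution_function (\<lambda>y. H y x \<theta>)) \<and>
     continuous_map
       (prod_topology euclidean
         (prod_topology (top_of_set X) (product_topology (\<lambda>l. mtopology_of (\<Theta> l)) UNIV)))
       euclideanreal (\<lambda>(y, x, \<theta>). H y x \<theta>)}"

definition gate ::
  "nat \<Rightarrow> (nat \<Rightarrow> real) \<Rightarrow> (nat \<Rightarrow> real^'p) \<Rightarrow> (nat \<Rightarrow> real^'l) \<Rightarrow> nat \<Rightarrow> real^'p \<Rightarrow> real^'l \<Rightarrow> real"
  where
  "gate g \<alpha>0 \<alpha> \<beta> j x w =
     exp (\<alpha>0 j + \<alpha> j \<bullet> x + \<beta> j \<bullet> w) / (\<Sum>j'\<in>{1..g}. exp (\<alpha>0 j' + \<alpha> j' \<bullet> x + \<beta> j' \<bullet> w))"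

definition mmoe_dfs ::
  "(real^'k \<Rightarrow> 'psi \<Rightarrow> real) \<Rightarrow> 'psi set \<Rightarrow> (real^'k \<Rightarrow> real^'p \<Rightarrow> real^'l \<Rightarrow> real) set" where
  "mmoe_dfs F0 \<Psi>0 = {\<lambda>y x w. \<Sum>j\<in>{1..g}. gate g \<alpha>0 \<alpha> \<beta> j x w * F0 y (\<psi> j) | g \<alpha>0 \<alpha> \<beta> \<psi>.
     1 \<le> g \<and> (\<forall>j\<in>{1..g}. \<psi> j \<in> \<Psi>0)}"

definition mmoe_models ::
  "(real^'k \<Rightarrow> 'psi \<Rightarrow> real) \<Rightarrow> 'psi set \<Rightarrow> ('l::finite \<Rightarrow> real measure) \<Rightarrow>
    ('l, real^'k, real^'p) model set" where
  "mmoe_models F0 \<Psi>0 \<Phi> = {joint_df \<Phi> (\<lambda>y x w. F y x (\<chi> l. w l)) | F. F \<in> mmoe_dfs F0 \<Psi>0}"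

definition compactly_dense ::
  "'x::topological_space set \<Rightarrow> ('l, 'y, 'x) model set \<Rightarrow> ('l, 'y, 'x) model set \<Rightarrow> bool" where
  "compactly_dense X M1 M2 \<longleftrightarrow>
     (\<forall>T\<in>M2. \<exists>A :: nat \<Rightarrow> ('l, 'y, 'x) model. (\<forall>n. A n \<in> M1) \<and>
       (\<forall>N S c Xbar. (\<forall>l. c l \<in> {1..N} \<rightarrow> {1..S l}) \<and> compact Xbar \<and> Xbar \<subseteq> X \<longrightarrow>
         uniform_limit {(y, x). \<forall>i\<in>{1..N}. x i \<in> Xbar}
           (\<lambda>n (y, x). A n N S c y x) (\<lambda>(y, x). T N S c y x) sequentially))"

end

theory Submission
  imports Defs
begin

text \<open>Both the covariates and the factors are discretised at the \<open>n\<close>-th step: \<open>\<theta> l\<close> is replaced by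
  the nearest among the first \<open>n + 1\<close> points of a dense sequence of \<open>\<Theta> l\<close>, and \<open>x\<close> by an average over
  the first \<open>n + 1\<close> points of a dense sequence of \<open>X\<close> with weights \<open>exp (- n * dist (x, a i)\<^sup>2)\<close>, which
  after normalisation are a softmax of affine functions of \<open>x\<close>. As \<open>\<Phi> l\<close> is atomless, the index of the
  nearest point has the same law as a step function of \<open>w l\<close>, and the indicators of the steps
  are limits of softmax weights with affine exponents; as products of softmax weights are softmax
  weights, all levels and the covariates are handled together. At each pair of representatives the continuous
  distribution function is approximated by a finite mixture of experts, uniformly in \<open>y\<close>
  by a version of Polya's theorem.

  Only the joint law of the discretised factors matters, so the discretised target may be
  integrated against \<open>G\<close> instead of \<open>\<Phi>\<close>. There it converges pointwise in the factors along any
  sequence of arguments \<open>(y, x)\<close>, and dominated convergence gives uniformity.\<close>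

section \<open>Uniform approximation of continuous distribution functions\<close>

text \<open>The two discretisations differ in kind. Mixing the values of \<open>H\<close> at several
  sites near \<open>x\<close> is harmless because \<open>H\<close> is continuous in
  \<open>x\<close>, so smooth weights suffice there. The dense sequences of the factor spaces follow
  no geometric order: adjacent steps in \<open>w l\<close> may stand for distant points of
  \<open>\<Theta> l\<close>, so the gate has to jump, and a continuous gate cannot follow a jump
  uniformly in \<open>w\<close>. The error in the random effects is therefore small only in the
  mean. This is enough although observations share units: all factors lie in [0, 1], so two products
  differ by at most the sum of the differences of their factors, and each summand involves one unit
  per level, whose law depends on neither \<open>S\<close> nor \<open>c\<close>. No uniformity in
  \<theta> is sought, since the spaces \<open>\<Theta> l\<close> need not be locally compact.
  \<open>orthant_monotone\<close> keeps of a distribution function just what lets finitely many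
  values control all others, in a form that passes to mixtures without building a mixture
  measure.\<close>

definition orthant_monotone :: "(real^'k \<Rightarrow> real) \<Rightarrow> bool" where
  "orthant_monotone F \<longleftrightarrow> (\<forall>y. 0 \<le> F y) \<and> (\<forall>y z. y \<le> z \<longrightarrow> F y \<le> F z) \<and>
     (\<forall>y t z. (\<forall>i. min (y $ i) (t $ i) \<le> z $ i) \<longrightarrow> F y + F t \<le> 1 + F z)"

lemma orthant_monotoneD:
  assumes "orthant_monotone F"
  shows "0 \<le> F y" "y \<le> z \<Longrightarrow> F y \<le> F z"
    "(\<And>i. min (y $ i) (t $ i) \<le> z $ i) \<Longrightarrow> F y + F t \<le> 1 + F z" "F y \<le> 1"
proof -
  show "0 \<le> F y" "y \<le> z \<Longrightarrow> F y \<le> F z"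
    "(\<And>i. min (y $ i) (t $ i) \<le> z $ i) \<Longrightarrow> F y + F t \<le> 1 + F z"
    using assms unfolding orthant_monotone_def by blast+
  have "\<forall>i. min (y $ i) (y $ i) \<le> y $ i" by simp
  then have "F y + F y \<le> 1 + F y"
    using assms unfolding orthant_monotone_def by blast
  then show "F y \<le> 1" by simp
qed

text \<open>The third clause is inclusion-exclusion with the probability of the union bounded by 1.
  It says that \<open>F y\<close> can exceed \<open>F z\<close> by no more than
  \<open>1 - F t\<close> when \<open>z\<close> dominates the componentwise minimum of
  \<open>y\<close> and \<open>t\<close>. With a high corner \<open>t\<close> this controls the upper
  tails.\<close>

lemma orthant_monotone_orthant_cdf:
  fixes M :: "(real^'k) measure"
  assumes "prob_space M" "sets M = sets borel"
  shows "orthant_monotone (orthant_cdf M)"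
proof -
  interpret prob_space M by fact
  have S: "{..y} \<in> events" for y :: "real^'k" using assms(2) by simp
  show ?thesis
    unfolding orthant_monotone_def orthant_cdf_def
  proof (intro conjI allI impI)
    fix y z :: "real^'k" assume "y \<le> z"
    then show "prob {..y} \<le> prob {..z}" using S by (intro finite_measure_mono) auto
  next
    fix y t z :: "real^'k" assume *: "\<forall>i. min (y $ i) (t $ i) \<le> z $ i"
    have "prob {..y} + prob {..t} = prob ({..y} \<union> {..t}) + prob ({..y} \<inter> {..t})"
      using S[of y] S[of t] by (simp add: measure_Un3 fmeasurable_eq_sets)
    moreover have "{..y} \<inter> {..t} \<subseteq> {..z}"
    proof
      fix w assume "w \<in> {..y} \<inter> {..t}"
      then have "w $ i \<le> z $ i" for i
        using *[rule_format, of i] by (auto simp: less_eq_vec_def min_def split: if_splits intro: order_trans)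
      then show "w \<in> {..z}" by (simp add: less_eq_vec_def)
    qed
    then have "prob ({..y} \<inter> {..t}) \<le> prob {..z}" using S by (intro finite_measure_mono) auto
    ultimately show "prob {..y} + prob {..t} \<le> 1 + prob {..z}"
      using prob_le_1[of "{..y} \<union> {..t}"] by linarith
  qed simp
qed

text \<open>Each clause is affine in \<open>F\<close>; the constant 1 in the third one is where the
  weights have to sum to 1.\<close>

lemma orthant_monotone_mixture:
  assumes "finite I" "\<And>i. i \<in> I \<Longrightarrow> 0 \<le> p i" "(\<Sum>i\<in>I. p i) = 1"
    "\<And>i. i \<in> I \<Longrightarrow> orthant_monotone (F i)"
  shows "orthant_monotone (\<lambda>y. \<Sum>i\<in>I. p i * F i y)"
  unfolding orthant_monotone_def
proof (intro conjI allI impI)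
  show "0 \<le> (\<Sum>i\<in>I. p i * F i y)" for y
    using assms by (intro sum_nonneg mult_nonneg_nonneg) (auto dest: orthant_monotoneD(1))
  show "(\<Sum>i\<in>I. p i * F i y) \<le> (\<Sum>i\<in>I. p i * F i z)" if "y \<le> z" for y z
    using assms that by (intro sum_mono mult_left_mono) (auto dest: orthant_monotoneD(2))
  fix y t z :: "real^'b" assume *: "\<forall>i. min (y $ i) (t $ i) \<le> z $ i"
  have "(\<Sum>i\<in>I. p i * F i y) + (\<Sum>i\<in>I. p i * F i t) = (\<Sum>i\<in>I. p i * (F i y + F i t))"
    by (simp add: sum.distrib algebra_simps)
  also have "\<dots> \<le> (\<Sum>i\<in>I. p i * (1 + F i z))"
    using assms * by (intro sum_mono mult_left_mono) (auto dest: orthant_monotoneD(3))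
  also have "\<dots> = 1 + (\<Sum>i\<in>I. p i * F i z)"
    using assms by (simp add: sum.distrib algebra_simps)
  finally show "(\<Sum>i\<in>I. p i * F i y) + (\<Sum>i\<in>I. p i * F i t) \<le> 1 + (\<Sum>i\<in>I. p i * F i z)" .
qed

text \<open>One box of mass above \<open>1 - e\<close> serves both tails: it is contained in the
  orthant at its upper corner, and, its lower inequalities being strict, it is disjoint from every
  orthant whose corner has a coordinate at most \<open>- T\<close>.\<close>

lemma orthant_cdf_tail:
  fixes M :: "(real^'k) measure"
  assumes "prob_space M" and sets: "sets M = sets borel" and "0 < e"
  obtains T where "0 < T" "1 - e < orthant_cdf M (\<chi> i. T)"
    "\<And>z i. z $ i \<le> - T \<Longrightarrow> orthant_cdf M z < e"
proof -
  interpret prob_space M by fact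
  have sp: "space M = UNIV" using sets by (metis sets_eq_imp_space_eq space_borel)
  define B where "B j = {z::real^'k. \<forall>i. - real j < z $ i \<and> z $ i \<le> real j}" for j
  have B: "B j \<in> events" for j
    unfolding sets B_def by measurable
  have inc: "incseq B" 
  proof (intro incseq_SucI subsetI)
    fix j z assume z: "z \<in> B j"
    have "- real (Suc j) < z $ i \<and> z $ i \<le> real (Suc j)" for i
      using z by (auto simp: B_def dest: spec[of _ i])
    then show "z \<in> B (Suc j)" by (simp add: B_def)
  qed
  have "(\<Union>j. B j) = UNIV"
  proof -
    have "z \<in> (\<Union>j. B j)" for z :: "real^'k"
    proof -
      obtain n :: nat where n: "norm z < n" using reals_Archimedean2 by blast
      have "\<bar>z $ i\<bar> < n" for i using component_le_norm_cart[of z i] n by linarith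
      then have "z \<in> B n" unfolding B_def by (auto simp: abs_less_iff intro: less_imp_le) (metis minus_less_iff)
      then show ?thesis by blast
    qed
    then show ?thesis by blast
  qed
  moreover have "(\<lambda>j. prob (B j)) \<longlonglongrightarrow> prob (\<Union>j. B j)"
    using B inc by (intro finite_Lim_measure_incseq) auto
  ultimately have "(\<lambda>j. prob (B j)) \<longlonglongrightarrow> 1" using sp prob_space by simp
  then have "eventually (\<lambda>j. 1 - e < prob (B j)) sequentially"
    using \<open>0 < e\<close> by (intro order_tendstoD(1)) auto
  then have "eventually (\<lambda>j. 1 - e < prob (B j) \<and> 1 \<le> j) sequentially"
    using eventually_ge_at_top by (rule eventually_conj)
  then obtain j where j: "1 - e < prob (B j)" "1 \<le> j" by (auto simp: eventually_sequentially)
  have S: "{..y} \<in> events" for y :: "real^'k" using sets by simp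
  show thesis
  proof
    show "0 < real j" using j by simp
    have "prob (B j) \<le> prob {..(\<chi> i. real j)}"
      using B S by (intro finite_measure_mono) (auto simp: B_def less_eq_vec_def)
    then show "1 - e < orthant_cdf M (\<chi> i. real j)" using j unfolding orthant_cdf_def by simp
    fix z :: "real^'k" and i assume z: "z $ i \<le> - real j"
    have "{..z} \<inter> B j = {}"
    proof -
      { fix w assume w: "w \<in> {..z}" "w \<in> B j"
        have "w $ i \<le> z $ i" using w by (simp add: less_eq_vec_def)
        moreover have "- real j < w $ i" using w by (simp add: B_def)
        ultimately have False using z by linarith }
      then show ?thesis by blast
    qed
    then have "prob {..z} + prob (B j) = prob ({..z} \<union> B j)"
      using S B by (intro finite_measure_Union[symmetric])
    then show "orthant_cdf M z < e"
      using j prob_le_1[of "{..z} \<union> B j"] unfolding orthant_cdf_def by linarith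
  qed
qed

text \<open>A quantitative form of Polya's theorem.\<close>

lemma distribution_function_determined_on_finite_set:
  fixes F :: "real^'k \<Rightarrow> real"
  assumes df: "distribution_function F" and cont: "continuous_on UNIV F" and "0 < e"
  obtains Y d where "finite Y" "0 < d"
    "\<And>F' y. orthant_monotone F' \<Longrightarrow> (\<And>y. y \<in> Y \<Longrightarrow> \<bar>F' y - F y\<bar> < d) \<Longrightarrow> \<bar>F' y - F y\<bar> < e"
proof -
  \<comment> \<open>The budget: \<open>F' y\<close> exceeds \<open>F' z\<close> at the clamped point
    \<open>z\<close> by less than \<open>2 * d\<close>, \<open>F' z\<close> is within
    \<open>2 * d\<close> of \<open>F z\<close>, and in the lower tail \<open>F z\<close> itself is
    below \<open>d\<close>. The total stays below \<open>6 * d\<close>.\<close>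
  define d where "d = e / 6"
  have d: "0 < d" using \<open>0 < e\<close> by (simp add: d_def)
  obtain M where M: "prob_space M" "sets M = sets borel" "F = orthant_cdf M"
    using df unfolding distribution_function_def by blast
  have FF: "orthant_monotone F" using M orthant_monotone_orthant_cdf by blast
  obtain T where T: "0 < T" "1 - d < F (\<chi> i. T)" "\<And>z i. z $ i \<le> - T \<Longrightarrow> F z < d"
    using orthant_cdf_tail[OF M(1,2) d] unfolding M(3) by metis
  define C where "C = cbox (\<chi> i::'k. - T) (\<chi> i. T)"
  have ex: "\<exists>r>0. F (z + (\<chi> i. r)) - F (z - (\<chi> i. r)) < d" for z
  proof -
    have "isCont F z" using cont by (simp add: continuous_on_eq_continuous_at)
    then obtain s where s: "0 < s" "\<And>w. dist w z < s \<Longrightarrow> dist (F w) (F z) < d / 2"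
      unfolding continuous_at_eps_delta using d by (metis half_gt_zero)
    define r where "r = s / 2 / (1 + real CARD('k))"
    have r: "0 < r" using s by (simp add: r_def add_pos_nonneg)
    have nr: "norm (\<chi> i::'k. r) < s"
    proof -
      have "norm (\<chi> i::'k. r) \<le> (\<Sum>i\<in>UNIV. \<bar>(\<chi> i::'k. r) $ i\<bar>)" by (rule norm_le_l1_cart)
      also have "\<dots> = real CARD('k) * r" using r by simp
      also have "\<dots> < s" unfolding r_def using s
        by (simp add: divide_simps add_pos_nonneg)
      finally show ?thesis .
    qed
    have "dist (F (z + (\<chi> i. r))) (F z) < d / 2" "dist (F (z - (\<chi> i. r))) (F z) < d / 2"
      using nr by (intro s(2); simp add: dist_norm)+
    then have "F (z + (\<chi> i. r)) - F (z - (\<chi> i. r)) < d"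
      unfolding dist_real_def by linarith
    then show ?thesis using r by blast
  qed
  then obtain r where r: "\<And>z. 0 < r z" "\<And>z. F (z + (\<chi> i. r z)) - F (z - (\<chi> i. r z)) < d"
    by metis
  define a where "a z = z - (\<chi> i. r z)" for z
  define b where "b z = z + (\<chi> i. r z)" for z
  have "compact C" unfolding C_def by (rule compact_cbox)
  moreover have "C \<subseteq> (\<Union>z\<in>C. box (a z) (b z))"
  proof
    fix z assume "z \<in> C"
    moreover have "z \<in> box (a z) (b z)" using r(1)[of z] by (simp add: a_def b_def mem_box_cart)
    ultimately show "z \<in> (\<Union>z\<in>C. box (a z) (b z))" by blast
  qed
  ultimately obtain D where D: "D \<subseteq> C" "finite D" "C \<subseteq> (\<Union>z\<in>D. box (a z) (b z))"
    using compactE_image[of C C "\<lambda>z. box (a z) (b z)"] by auto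
  \<comment> \<open>A monotone function is pinned inside a box by its values at the two extreme
    corners. The point with all coordinates \<open>T\<close> is added to bound what is gained beyond
    the cube.\<close>
  define Y where "Y = insert (\<chi> i. T) (a ` D \<union> b ` D)"
  show thesis
  proof (rule that[of Y d])
    show "finite Y" using D by (simp add: Y_def)
    fix F' :: "real^'k \<Rightarrow> real" and y :: "real^'k"
    assume F': "orthant_monotone F'" and Y: "\<And>y. y \<in> Y \<Longrightarrow> \<bar>F' y - F y\<bar> < d"
    \<comment> \<open>The projection of \<open>y\<close> to the cube \<open>C\<close>. It dominates
      the minimum of \<open>y\<close> and the top corner, so the third clause bounds
      \<open>F y\<close> and \<open>F' y\<close> from above. For the lower bounds, either
      \<open>z \<le> y\<close>, or some coordinate is below \<open>- T\<close> and both
      \<open>F z\<close> and \<open>F y\<close> are negligible.\<close>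
    define z where "z = (\<chi> i. max (- T) (min (y $ i) T))"
    have "z \<in> C" using T(1) by (auto simp: C_def z_def mem_box_cart)
    then obtain q where q: "q \<in> D" "z \<in> box (a q) (b q)" using D by blast
    have zab: "a q \<le> z" "z \<le> b q"
      using q(2) by (auto simp: mem_box_cart less_eq_vec_def intro: less_imp_le)
    have ab: "F (b q) - F (a q) < d" using r(2) by (simp add: a_def b_def)
    have Ya: "\<bar>F' (a q) - F (a q)\<bar> < d" "\<bar>F' (b q) - F (b q)\<bar> < d"
      "\<bar>F' (\<chi> i. T) - F (\<chi> i. T)\<bar> < d" using q(1) by (auto intro!: Y simp: Y_def)
    have m: "min (y $ i) ((\<chi> i. T) $ i) \<le> z $ i" for i by (simp add: z_def)
    have up': "F' y + F' (\<chi> i. T) \<le> 1 + F' z" by (rule orthant_monotoneD(3)[OF F' m])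
    have up: "F y + F (\<chi> i. T) \<le> 1 + F z" by (rule orthant_monotoneD(3)[OF FF m])
    have z1: "F' (a q) \<le> F' z" "F' z \<le> F' (b q)" "F (a q) \<le> F z" "F z \<le> F (b q)"
      using zab orthant_monotoneD(2)[OF F'] orthant_monotoneD(2)[OF FF] by auto
    have zy: "(F z < d \<and> F y < d) \<or> (F z \<le> F y \<and> F' z \<le> F' y)"
    proof (cases "\<exists>i. y $ i < - T")
      case True
      then obtain i where i: "y $ i < - T" by blast
      then have "z $ i \<le> - T" by (simp add: z_def)
      then show ?thesis using T(3)[of z i] T(3)[of y i] i by auto
    next
      case False
      then have "z \<le> y" by (auto simp: z_def less_eq_vec_def not_less)
      then show ?thesis using orthant_monotoneD(2)[OF F'] orthant_monotoneD(2)[OF FF] by auto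
    qed
    have nn: "0 \<le> F' y" "0 \<le> F y" using orthant_monotoneD(1) F' FF by auto
    have "\<bar>F' y - F y\<bar> < 6 * d"
      using zy
    proof
      assume "F z < d \<and> F y < d"
      then show ?thesis using nn up up' z1 Ya ab T(2) by linarith
    next
      assume "F z \<le> F y \<and> F' z \<le> F' y"
      then show ?thesis using nn up up' z1 Ya ab T(2) by linarith
    qed
    then show "\<bar>F' y - F y\<bar> < e" by (simp add: d_def)
  qed (rule d)
qed

section \<open>Finite mixtures of nearly degenerate experts\<close>

lemma orthant_cdf_return: "orthant_cdf (return borel q) y = (if q \<le> y then 1 else 0)"
  by (simp add: orthant_cdf_def measure_return indicator_def)

lemma isCont_orthant_cdf_return:
  fixes q y :: "real^'k"
  assumes "(\<forall>i. q $ i < y $ i) \<or> (\<exists>i. y $ i < q $ i)"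
  shows "isCont (orthant_cdf (return borel q)) y"
  using assms
proof
  assume "\<forall>i. q $ i < y $ i"
  then have "eventually (\<lambda>z. \<forall>i\<in>UNIV. q $ i < z $ i) (nhds y)"
    by (intro eventually_ball_finite ballI order_tendstoD(1)[OF tendsto_vec_nth]) (auto intro: filterlim_ident)
  then have "eventually (\<lambda>z. orthant_cdf (return borel q) z = 1) (nhds y)"
    by eventually_elim (auto simp: orthant_cdf_return less_eq_vec_def intro: less_imp_le)
  then show ?thesis using isCont_cong[of "orthant_cdf (return borel q)" "\<lambda>_. 1" y] by simp
next
  assume "\<exists>i. y $ i < q $ i"
  then obtain i where "y $ i < q $ i" by blast
  then have "eventually (\<lambda>z. z $ i < q $ i) (nhds y)"
    by (intro order_tendstoD(2)[OF tendsto_vec_nth]) (auto intro: filterlim_ident)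
  then have "eventually (\<lambda>z. orthant_cdf (return borel q) z = 0) (nhds y)"
    by eventually_elim (auto simp: orthant_cdf_return less_eq_vec_def not_le)
  then show ?thesis using isCont_cong[of "orthant_cdf (return borel q)" "\<lambda>_. 0" y] by simp
qed

text \<open>By the quantitative Polya theorem only finitely many points \<open>Y\<close> matter, and
  a point \<open>z\<close> is seen from \<open>Y\<close> only through \<open>sig z\<close>. This
  splits the space into finitely many cells, named by their signatures. One expert close to a point
  mass in each cell, weighted by the mass of the cell under \<open>M\<close>, reproduces
  \<open>F\<close> on \<open>Y\<close> up to \<open>d\<close>. Null cells are discarded because the
  weights later enter the gate through their logarithms.\<close>

lemma approximate_by_expert_mixture:
  fixes F0 :: "real^'k \<Rightarrow> 'psi \<Rightarrow> real" and F :: "real^'k \<Rightarrow> real"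
  assumes F0_df: "\<And>\<psi>. \<psi> \<in> \<Psi>0 \<Longrightarrow> distribution_function (\<lambda>y. F0 y \<psi>)"
    and F0_dense: "\<And>q :: real^'k. \<exists>\<psi> :: nat \<Rightarrow> 'psi. (\<forall>n. \<psi> n \<in> \<Psi>0) \<and>
          weak_conv_vec (\<lambda>n y. F0 y (\<psi> n)) (orthant_cdf (return borel q))"
    and df: "distribution_function F" and cont: "continuous_on UNIV F" and "0 < e"
  shows "\<exists>(C :: (real^'k) set set) p \<psi>. finite C \<and> (\<forall>A\<in>C. 0 < p A \<and> \<psi> A \<in> \<Psi>0) \<and> (\<Sum>A\<in>C. p A) = (1::real) \<and>
     (\<forall>y. \<bar>(\<Sum>A\<in>C. p A * F0 y (\<psi> A)) - F y\<bar> < e)"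
proof -
  obtain Y d where Y: "finite Y" "0 < d" 
    "\<And>F' y. orthant_monotone F' \<Longrightarrow> (\<And>y. y \<in> Y \<Longrightarrow> \<bar>F' y - F y\<bar> < d) \<Longrightarrow> \<bar>F' y - F y\<bar> < e"
    using distribution_function_determined_on_finite_set[OF df cont \<open>0 < e\<close>] by metis
  obtain M where M: "prob_space M" "sets M = sets borel" "F = orthant_cdf M"
    using df unfolding distribution_function_def by blast
  interpret prob_space M by fact
  have sp: "space M = UNIV" using M(2) by (metis sets_eq_imp_space_eq space_borel)
  define sig where "sig z = {y\<in>Y. z \<le> y}" for z
  have S: "{..y} \<in> events" for y :: "real^'k" using M(2) by simp
  have meas: "{z. sig z = A} \<in> events" for A
  proof (cases "A \<subseteq> Y")
    case True
    then have "{z. sig z = A} = {z\<in>space M. \<forall>y\<in>Y. z \<in> {..y} \<longleftrightarrow> y \<in> A}" by (auto simp: sig_def sp)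
    also have "\<dots> \<in> events"
    proof (intro sets.sets_Collect_finite_All Y(1))
      fix y
      have "{z\<in>space M. z \<in> {..y} \<longleftrightarrow> y \<in> A} = (if y \<in> A then {..y} else space M - {..y})"
        by (auto simp: sp)
      also have "\<dots> \<in> events" using S[of y] by auto
      finally show "{z\<in>space M. z \<in> {..y} \<longleftrightarrow> y \<in> A} \<in> events" .
    qed
    finally show ?thesis .
  next
    case False
    then have "{z. sig z = A} = {}" by (auto simp: sig_def)
    then show ?thesis by (simp only: sets.empty_sets)
  qed
  define p where "p A = prob {z. sig z = A}" for A
  define C where "C = {A\<in>Pow Y. 0 < p A}"
  have fin: "finite C" using Y(1) by (simp add: C_def)
  have ex: "\<exists>\<psi>\<in>\<Psi>0. \<forall>y\<in>Y. \<bar>F0 y \<psi> - (if y \<in> A then 1 else 0)\<bar> < d" if "A \<in> C" for A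
  proof -
    have "{z. sig z = A} \<noteq> {}"
    proof
      assume "{z. sig z = A} = {}"
      then have "p A = 0" by (simp only: p_def measure_empty)
      with that show False by (simp add: C_def)
    qed
    then obtain z where z: "sig z = A" by blast
    \<comment> \<open>A point of \<open>Y\<close> that is not above \<open>z\<close> falls short of
      it strictly in some coordinate; as \<open>Y\<close> is finite, one small shift preserves all
      these gaps.\<close>
    have "eventually (\<lambda>r. \<forall>y\<in>Y. y \<notin> A \<longrightarrow> (\<exists>i. y $ i < z $ i - r)) (at_right 0)"
    proof (intro eventually_ball_finite ballI Y(1))
      fix y assume y: "y \<in> Y"
      show "eventually (\<lambda>r. y \<notin> A \<longrightarrow> (\<exists>i. y $ i < z $ i - r)) (at_right 0)"
      proof (cases "y \<in> A")
        case False
        then have "\<not> z \<le> y" using y z by (auto simp: sig_def)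
        then obtain i where i: "y $ i < z $ i" by (auto simp: less_eq_vec_def not_le)
        have "eventually (\<lambda>r. r < z $ i - y $ i) (at_right 0)"
          using i by (intro eventually_at_right_real[THEN eventually_mono]) auto
        then show ?thesis by eventually_elim (auto intro!: exI[of _ i])
      qed simp
    qed
    then obtain r where r: "0 < r" "\<And>y. y \<in> Y \<Longrightarrow> y \<notin> A \<Longrightarrow> \<exists>i. y $ i < z $ i - r"
      unfolding eventually_at_right_field by (metis dense)
    \<comment> \<open>Moving \<open>z\<close> down the diagonal stays in its cell and makes all points of \<open>Y\<close> continuity points of the
      point mass at \<open>q\<close>.\<close>
    define q where "q = z - (\<chi> i. r)"
    obtain \<psi> where \<psi>: "\<And>n. \<psi> n \<in> \<Psi>0" "weak_conv_vec (\<lambda>n y. F0 y (\<psi> n)) (orthant_cdf (return borel q))"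
      using F0_dense[of q] by blast
    have "eventually (\<lambda>n. \<forall>y\<in>Y. \<bar>F0 y (\<psi> n) - (if y \<in> A then 1 else 0)\<bar> < d) sequentially"
    proof (intro eventually_ball_finite ballI Y(1))
      fix y assume y: "y \<in> Y"
      have 1: "(\<forall>i. q $ i < y $ i) \<and> y \<in> A \<or> (\<exists>i. y $ i < q $ i) \<and> y \<notin> A"
      proof (cases "y \<in> A")
        case True
        then have "z \<le> y" using z by (auto simp: sig_def)
        then have "q $ i < y $ i" for i using r(1) by (simp add: q_def less_eq_vec_def) (smt (verit))
        with True show ?thesis by blast
      next
        case False with r(2)[OF y False] show ?thesis by (simp add: q_def)
      qed
      have "q \<le> y \<longleftrightarrow> y \<in> A"
      proof (cases "y \<in> A")
        case True
        with 1 show ?thesis by (simp add: less_eq_vec_def less_imp_le)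
      next
        case False
        with 1 obtain i where "y $ i < q $ i" by blast
        then have "\<not> q \<le> y" by (auto simp: less_eq_vec_def not_le)
        with False show ?thesis by simp
      qed
      then have "orthant_cdf (return borel q) y = (if y \<in> A then 1 else 0)"
        by (simp add: orthant_cdf_return)
      moreover have "isCont (orthant_cdf (return borel q)) y" using 1 by (intro isCont_orthant_cdf_return) blast
      then have "(\<lambda>n. F0 y (\<psi> n)) \<longlonglongrightarrow> orthant_cdf (return borel q) y"
        using \<psi>(2) unfolding weak_conv_vec_def by blast
      ultimately have "(\<lambda>n. F0 y (\<psi> n)) \<longlonglongrightarrow> (if y \<in> A then 1 else 0)" by (simp only:)
      then show "eventually (\<lambda>n. \<bar>F0 y (\<psi> n) - (if y \<in> A then 1 else 0)\<bar> < d) sequentially"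
        unfolding dist_real_def[symmetric] by (rule tendstoD[OF _ Y(2)])
    qed
    then show ?thesis using \<psi>(1) unfolding eventually_sequentially by blast
  qed
  then obtain \<psi> where \<psi>: "\<And>A. A \<in> C \<Longrightarrow> \<psi> A \<in> \<Psi>0"
    "\<And>A y. A \<in> C \<Longrightarrow> y \<in> Y \<Longrightarrow> \<bar>F0 y (\<psi> A) - (if y \<in> A then 1 else 0)\<bar> < d"
    by metis
  \<comment> \<open>Used twice: with \<open>Q\<close> constantly true it gives total weight 1, and
    with membership of \<open>y\<close> it gives \<open>F y\<close>.\<close>
  have psum: "(\<Sum>A\<in>C. p A * (if Q A then 1 else 0)) = prob {z. Q (sig z)}" for Q
  proof -
    have "(\<Sum>A\<in>C. p A * (if Q A then 1 else 0)) = (\<Sum>A\<in>Pow Y. p A * (if Q A then 1 else 0))"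
      using Y(1) by (intro sum.mono_neutral_left) (auto simp: C_def p_def less_le)
    also have "\<dots> = (\<Sum>A\<in>{A\<in>Pow Y. Q A}. p A)"
      using Y(1) by (intro sum.mono_neutral_cong_right) auto
    also have "\<dots> = prob (\<Union>A\<in>{A\<in>Pow Y. Q A}. {z. sig z = A})"
      unfolding p_def using Y(1) meas
      by (intro finite_measure_finite_Union[symmetric]) (auto simp: disjoint_family_on_def)
    also have "(\<Union>A\<in>{A\<in>Pow Y. Q A}. {z. sig z = A}) = {z. Q (sig z)}" by (auto simp: sig_def)
    finally show ?thesis .
  qed
  have p1: "(\<Sum>A\<in>C. p A) = 1" using psum[of "\<lambda>_. True"] prob_space sp by simp
  have "\<bar>(\<Sum>A\<in>C. p A * F0 y (\<psi> A)) - F y\<bar> < e" for y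
  proof (rule Y(3))
    show "orthant_monotone (\<lambda>y. \<Sum>A\<in>C. p A * F0 y (\<psi> A))"
    proof (rule orthant_monotone_mixture[OF fin _ p1])
      fix A assume "A \<in> C"
      then obtain M' where "prob_space M'" "sets M' = sets borel" "(\<lambda>y. F0 y (\<psi> A)) = orthant_cdf M'"
        using F0_df[OF \<psi>(1)] unfolding distribution_function_def by blast
      then show "orthant_monotone (\<lambda>y. F0 y (\<psi> A))" using orthant_monotone_orthant_cdf by metis
    qed (simp add: C_def)
    fix y assume y: "y \<in> Y"
    have "F y = (\<Sum>A\<in>C. p A * (if y \<in> A then 1 else 0))"
    proof -
      have "{z. y \<in> sig z} = {..y}" using y by (auto simp: sig_def)
      then show ?thesis by (simp add: psum M(3) orthant_cdf_def)
    qed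
    then have "\<bar>(\<Sum>A\<in>C. p A * F0 y (\<psi> A)) - F y\<bar> = \<bar>\<Sum>A\<in>C. p A * (F0 y (\<psi> A) - (if y \<in> A then 1 else 0))\<bar>"
      by (simp add: sum_subtractf right_diff_distrib)
    also have "\<dots> \<le> (\<Sum>A\<in>C. \<bar>p A * (F0 y (\<psi> A) - (if y \<in> A then 1 else 0))\<bar>)" by (rule sum_abs)
    also have "\<dots> < (\<Sum>A\<in>C. p A * d)"
    proof (rule sum_strict_mono)
      show "C \<noteq> {}" using p1 by auto
      fix A assume A: "A \<in> C"
      then have "0 < p A" by (simp add: C_def)
      then show "\<bar>p A * (F0 y (\<psi> A) - (if y \<in> A then 1 else 0))\<bar> < p A * d"
        using \<psi>(2)[OF A y] by (simp add: abs_mult)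
    qed (rule fin)
    also have "\<dots> = d" using p1 by (simp add: sum_distrib_right[symmetric])
    finally show "\<bar>(\<Sum>A\<in>C. p A * F0 y (\<psi> A)) - F y\<bar> < d" .
  qed
  then show ?thesis using fin p1 \<psi>(1) by (intro exI[of _ C] exI[of _ p] exI[of _ \<psi>]) (auto simp: C_def)
qed

section \<open>Softmax weights on the real line\<close>

text \<open>Frees the construction from the indices \<open>{1..g}\<close>: the experts will be
  indexed by triples.\<close>

lemma softmax_mixture_in_mmoe_dfs:
  fixes \<alpha>0 :: "'i \<Rightarrow> real" and \<alpha> :: "'i \<Rightarrow> real^'p" and \<beta> :: "'i \<Rightarrow> real^'l" and F0 :: "real^'k \<Rightarrow> 'psi \<Rightarrow> real"
  assumes "finite I" "I \<noteq> {}" "\<And>i. i \<in> I \<Longrightarrow> \<psi> i \<in> \<Psi>0"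
  shows "(\<lambda>y x w. \<Sum>i\<in>I. exp (\<alpha>0 i + \<alpha> i \<bullet> x + \<beta> i \<bullet> w) / (\<Sum>i'\<in>I. exp (\<alpha>0 i' + \<alpha> i' \<bullet> x + \<beta> i' \<bullet> w)) * F0 y (\<psi> i))
    \<in> mmoe_dfs F0 \<Psi>0"
proof -
  define g where "g = card I"
  obtain h where h: "bij_betw h {1..g} I"
    using ex_bij_betw_nat_finite_1[OF assms(1)] unfolding g_def by blast
  have re: "(\<Sum>j\<in>{1..g}. f (h j)) = sum f I" for f :: "'i \<Rightarrow> real"
    by (rule sum.reindex_bij_betw[OF h])
  have "(\<lambda>y x w. \<Sum>i\<in>I. exp (\<alpha>0 i + \<alpha> i \<bullet> x + \<beta> i \<bullet> w) / (\<Sum>i'\<in>I. exp (\<alpha>0 i' + \<alpha> i' \<bullet> x + \<beta> i' \<bullet> w)) * F0 y (\<psi> i))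
     = (\<lambda>y x w. \<Sum>j\<in>{1..g}. gate g (\<alpha>0 \<circ> h) (\<alpha> \<circ> h) (\<beta> \<circ> h) j x w * F0 y ((\<psi> \<circ> h) j))"
  proof (intro ext)
    fix y :: "real^'k" and x :: "real^'p" and w :: "real^'l"
    have den: "(\<Sum>j\<in>{1..g}. exp (\<alpha>0 (h j) + \<alpha> (h j) \<bullet> x + \<beta> (h j) \<bullet> w)) =
        (\<Sum>i\<in>I. exp (\<alpha>0 i + \<alpha> i \<bullet> x + \<beta> i \<bullet> w))"
      by (rule re)
    show "(\<Sum>i\<in>I. exp (\<alpha>0 i + \<alpha> i \<bullet> x + \<beta> i \<bullet> w) / (\<Sum>i'\<in>I. exp (\<alpha>0 i' + \<alpha> i' \<bullet> x + \<beta> i' \<bullet> w)) * F0 y (\<psi> i))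
      = (\<Sum>j\<in>{1..g}. gate g (\<alpha>0 \<circ> h) (\<alpha> \<circ> h) (\<beta> \<circ> h) j x w * F0 y ((\<psi> \<circ> h) j))"
      unfolding gate_def o_def den by (rule re[symmetric])
  qed
  moreover have "1 \<le> g" using assms by (simp add: g_def Suc_le_eq card_gt_0_iff)
  moreover have "\<forall>j\<in>{1..g}. (\<psi> \<circ> h) j \<in> \<Psi>0"
    using h assms(3) by (auto simp: bij_betw_def)
  ultimately show ?thesis unfolding mmoe_dfs_def by blast
qed

section \<open>Quantiles and the probability integral transform\<close>

lemma level_set_below_eq_atMost:
  assumes "real_distribution M" "continuous_on UNIV (cdf M)" "0 < u" "u < 1"
  obtains t where "cdf M t = u" "\<And>w. cdf M w \<le> u \<longleftrightarrow> w \<le> t"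
proof -
  interpret real_distribution M by fact
  have "eventually (\<lambda>w. cdf M w < u) at_bot" using order_tendstoD(2)[OF cdf_lim_at_bot] assms(3) .
  then obtain a where a: "cdf M a < u" by (metis eventually_at_bot_linorder order_refl)
  have "eventually (\<lambda>w. u < cdf M w) at_top" using order_tendstoD(1)[OF cdf_lim_at_top_prob] assms(4) .
  then obtain b where b: "u < cdf M b" by (metis eventually_at_top_linorder order_refl)
  \<comment> \<open>The distribution function may be flat at height \<open>u\<close>, so an
    arbitrary solution of \<open>cdf M t = u\<close> need not bound the whole level set. Its
    supremum does; the intermediate value theorem is used only to see that the height
    \<open>u\<close> is attained there.\<close>
  define A where "A = {w. cdf M w \<le> u}"
  have A: "a \<in> A" "closed A" using a assms(2) unfolding A_def
    by (auto intro!: closed_Collect_le simp: continuous_on_const)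
  have lower: "w \<in> A" if "w \<le> w'" "w' \<in> A" for w w'
    using that cdf_nondecreasing[of w w'] by (auto simp: A_def)
  have bdd: "w \<le> b" if "w \<in> A" for w
    using that b lower[of b w] by (force simp: A_def)
  then have bdd': "bdd_above A" by (auto simp: bdd_above_def)
  have SA: "Sup A \<in> A" using A bdd' by (intro closed_contains_Sup) auto
  have le: "cdf M w \<le> u \<longleftrightarrow> w \<le> Sup A" for w
    using lower[of w "Sup A"] SA cSup_upper[OF _ bdd', of w] by (auto simp: A_def)
  have "\<exists>t\<ge>a. t \<le> b \<and> cdf M t = u"
    using a b bdd[OF A(1)] assms(2) by (intro IVT') (auto intro: continuous_on_subset)
  then obtain t where t: "cdf M t = u" by blast
  then have "t \<le> Sup A" using le[of t] by simp
  then have "u \<le> cdf M (Sup A)" using cdf_nondecreasing[of t "Sup A"] t by simp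
  with le[of "Sup A"] have "cdf M (Sup A) = u" by simp
  then show thesis using that le by blast
qed

text \<open>This is the probability integral transform: \<open>cdf M\<close> is uniformly
  distributed under \<open>M\<close>. Inside the unit interval the level set is a half-line ending
  at a quantile; the level 0 need not be attained and is reached by a limit from above.\<close>

lemma measure_cdf_le:
  assumes "real_distribution M" "continuous_on UNIV (cdf M)" "0 \<le> u" "u \<le> 1"
  shows "measure M {w. cdf M w \<le> u} = u"
proof -
  interpret real_distribution M by fact
  have cl: "closed {w. cdf M w \<le> v}" for v
    using assms(2) by (intro closed_Collect_le) auto
  have S: "{w. cdf M w \<le> v} \<in> events" for v
    using borel_closed[OF cl[of v]] by simp
  have in01: "measure M {w. cdf M w \<le> v} = v" if v: "0 < v" "v < 1" for v
  proof -
    obtain t where t: "cdf M t = v" "\<And>w. cdf M w \<le> v \<longleftrightarrow> w \<le> t"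
      using level_set_below_eq_atMost[OF assms(1,2) v] by metis
    then have "{w. cdf M w \<le> v} = {..t}" by auto
    then show ?thesis using t(1) by (simp add: cdf_def)
  qed
  consider "u = 0" | "0 < u" "u < 1" | "u = 1" using assms by linarith
  then show ?thesis
  proof cases
    case 1
    have "measure M {w. cdf M w \<le> 0} \<le> 0 + e" if "0 < e" for e
    proof -
      \<comment> \<open>The cap \<open>1/2\<close> keeps the comparison level strictly below 1,
        where \<open>in01\<close> applies.\<close>
      have "measure M {w. cdf M w \<le> 0} \<le> measure M {w. cdf M w \<le> min e (1/2)}"
        using S[of "min e (1/2)"] that by (intro finite_measure_mono) auto
      also have "\<dots> = min e (1/2)" using that by (intro in01) auto
      finally show ?thesis by simp
    qed
    then have "measure M {w. cdf M w \<le> 0} \<le> 0" by (rule field_le_epsilon)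
    then show ?thesis using 1 measure_nonneg[of M "{w. cdf M w \<le> 0}"] by simp
  next
    case 3
    then have "{w. cdf M w \<le> u} = space M" using cdf_bounded_prob by auto
    then show ?thesis using 3 prob_space by simp
  qed (rule in01)
qed

text \<open>A level set can be a whole interval, but it lies between two sublevel sets whose masses
  differ by at most \<open>e\<close>. This makes the jumps of the step function below
  negligible.\<close>

lemma measure_cdf_eq:
  assumes "real_distribution M" "continuous_on UNIV (cdf M)"
  shows "measure M {w. cdf M w = u} = 0"
proof -
  interpret real_distribution M by fact
  have cl: "closed {w. cdf M w \<le> v}" for v
    using assms(2) by (intro closed_Collect_le) auto
  have S: "{w. cdf M w \<le> v} \<in> events" for v
    using borel_closed[OF cl[of v]] by simp
  consider "u < 0 \<or> 1 < u" | "u = 0" | "0 < u" "u \<le> 1" by linarith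
  then show ?thesis
  proof cases
    case 1
    then have "cdf M w \<noteq> u" for w using cdf_bounded_prob[of w] cdf_nonneg[of w] by linarith
    then have "{w. cdf M w = u} = {}" by simp
    then show ?thesis by (simp only: measure_empty)
  next
    case 2
    then have "{w. cdf M w = u} = {w. cdf M w \<le> 0}" using cdf_nonneg by (auto simp: order.antisym)
    then show ?thesis using measure_cdf_le[OF assms, of 0] by simp
  next
    case 3
    have "measure M {w. cdf M w = u} \<le> 0 + e" if "0 < e" for e
    proof -
      define v where "v = max 0 (u - e)"
      have v: "0 \<le> v" "v < u" "u - v \<le> e" using 3 that by (auto simp: v_def)
      have "measure M {w. cdf M w = u} \<le> measure M ({w. cdf M w \<le> u} - {w. cdf M w \<le> v})"
        using S v by (intro finite_measure_mono) auto
      also have "\<dots> = measure M {w. cdf M w \<le> u} - measure M {w. cdf M w \<le> v}"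
        using S v by (intro finite_measure_Diff) auto
      also have "\<dots> = u - v" using measure_cdf_le[OF assms, of u] measure_cdf_le[OF assms, of v] v 3 by simp
      finally show ?thesis using v by simp
    qed
    then have "measure M {w. cdf M w = u} \<le> 0" by (rule field_le_epsilon)
    then show ?thesis using measure_nonneg[of M "{w. cdf M w = u}"] by simp
  qed
qed

text \<open>The exponent \<open>s j * w + r j\<close> is \<open>k * (\<Sum>i\<in>{1..j}. w - t i)\<close> with \<open>t i\<close> the quantile of
  order \<open>P i = p 0 + \<dots> + p (i - 1)\<close>, truncated to \<open>- k\<close> or \<open>k\<close> when \<open>P i\<close> is \<open>0\<close> or \<open>1\<close>. As
  \<open>k\<close> grows, the softmax weights concentrate on the \<open>j\<close> with \<open>P j < cdf M w < P (Suc j)\<close>.\<close>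

lemma affine_softmax_approximates_step_function:
  fixes p :: "nat \<Rightarrow> real"
  assumes M: "real_distribution M" "continuous_on UNIV (cdf M)"
    and p: "\<And>j. j \<le> n \<Longrightarrow> 0 \<le> p j" "(\<Sum>j\<le>n. p j) = 1" and "0 < e"
  shows "\<exists>J s r. J \<in> measurable M (count_space UNIV) \<and> (\<forall>w. J w \<le> n) \<and>
    (\<forall>j\<le>n. measure M {w. J w = j} = p j) \<and>
    (\<integral>w. 1 - exp (s (J w) * w + r (J w)) / (\<Sum>j\<le>n. exp (s j * w + r j)) \<partial>M) < (e::real)"
proof -
  interpret real_distribution M by fact
  define P where "P j = (\<Sum>i<j. p i)" for j
  have P_mono: "P i \<le> P j" if "i \<le> j" "j \<le> Suc n" for i j
    unfolding P_def using that p(1) by (intro sum_mono2) auto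
  have P0: "P 0 = 0" by (simp add: P_def)
  have P1: "P (Suc n) = 1" using p(2) by (simp add: P_def lessThan_Suc_atMost)
  have P01: "0 \<le> P j" "P j \<le> 1" if "j \<le> Suc n" for j
    using P_mono[of 0 j] P_mono[of j "Suc n"] that P0 P1 by auto
  have [measurable]: "cdf M \<in> borel_measurable M"
    using borel_measurable_continuous_onI[OF M(2)] by simp
  \<comment> \<open>Inverse transform sampling: \<open>cdf M w\<close> is uniform, and
    \<open>J w\<close> records in which of the consecutive intervals of lengths \<open>p 0\<close>,
    \<open>p 1\<close>, ... it falls.\<close>
  define J where "J w = (LEAST j. cdf M w \<le> P (Suc j))" for w
  have Jex: "cdf M w \<le> P (Suc n)" for w using cdf_bounded_prob P1 by simp
  have J_le: "J w \<le> j \<longleftrightarrow> cdf M w \<le> P (Suc j)" if "j \<le> n" for w j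
  proof
    assume "J w \<le> j"
    moreover have "cdf M w \<le> P (Suc (J w))" unfolding J_def by (rule LeastI[of "\<lambda>j. cdf M w \<le> P (Suc j)", OF Jex])
    ultimately show "cdf M w \<le> P (Suc j)" using P_mono[of "Suc (J w)" "Suc j"] that by simp
  next
    assume "cdf M w \<le> P (Suc j)" then show "J w \<le> j" unfolding J_def by (rule Least_le)
  qed
  have Jn: "J w \<le> n" for w using J_le[of n w] Jex by simp
  have Jm [measurable]: "J \<in> measurable M (count_space UNIV)"
    unfolding J_def by measurable
  have mle: "measure M {w. J w \<le> j} = P (Suc j)" if "j \<le> n" for j
    using J_le[OF that] measure_cdf_le[OF M, of "P (Suc j)"] P01[of "Suc j"] that by simp
  have S: "{w. J w \<le> j} \<in> events" for j
    using measurable_sets[OF Jm, of "{..j}"] by (simp add: vimage_def)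
  have law: "measure M {w. J w = j} = p j" if "j \<le> n" for j
  proof (cases j)
    case 0
    then show ?thesis using mle[of 0] by (simp add: P_def)
  next
    case (Suc i)
    then have "{w. J w = j} = {w. J w \<le> j} - {w. J w \<le> i}" by auto
    also have "measure M \<dots> = measure M {w. J w \<le> j} - measure M {w. J w \<le> i}"
      using S Suc by (intro finite_measure_Diff) auto
    also have "\<dots> = p j" using mle[of j] mle[of i] that Suc by (simp add: P_def)
    finally show ?thesis .
  qed
  have "\<exists>t. 0 < P i \<and> P i < 1 \<longrightarrow> cdf M t = P i \<and> (\<forall>w. cdf M w \<le> P i \<longleftrightarrow> w \<le> t)" for i
    using level_set_below_eq_atMost[OF M, of "P i"] by metis
  then obtain q where q: "\<And>i. 0 < P i \<Longrightarrow> P i < 1 \<Longrightarrow> cdf M (q i) = P i"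
    "\<And>i w. 0 < P i \<Longrightarrow> P i < 1 \<Longrightarrow> cdf M w \<le> P i \<longleftrightarrow> w \<le> q i" by metis
  define t :: "nat \<Rightarrow> nat \<Rightarrow> real"
    where "t k i = (if P i \<le> 0 then - real k else if 1 \<le> P i then real k else q i)" for k i
  define s :: "nat \<Rightarrow> nat \<Rightarrow> real" where "s k j = real k * real j" for k j
  define r :: "nat \<Rightarrow> nat \<Rightarrow> real" where "r k j = - real k * (\<Sum>i\<in>{1..j}. t k i)" for k j
  have v: "s k j * w + r k j = (\<Sum>i\<in>{1..j}. real k * (w - t k i))" for k j w
    by (simp add: s_def r_def right_diff_distrib sum_subtractf sum_distrib_left sum_negf)
  have below: "(\<lambda>k. exp (- (real k * (w - t k i)))) \<longlonglongrightarrow> 0" if lt: "P i < cdf M w" for w i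
  proof -
    \<comment> \<open>A threshold of order 0 recedes to minus infinity as \<open>k\<close> grows, so
      a gap independent of \<open>k\<close> exists only eventually. At a genuine quantile the gap is
      \<open>w - q i\<close> for every \<open>k\<close>.\<close>
    obtain c where c: "0 < c" "eventually (\<lambda>k. c \<le> w - t k i) sequentially"
    proof (cases "P i \<le> 0")
      case True
      have "eventually (\<lambda>k. 1 - w \<le> real k) sequentially"
        by (rule eventually_sequentiallyI[of "nat \<lceil>1 - w\<rceil>"]) linarith
      then have "eventually (\<lambda>k. 1 \<le> w - t k i) sequentially"
        by eventually_elim (simp add: t_def True)
      then show thesis using that[of 1] by simp
    next
      case False
      moreover have "P i < 1" using lt cdf_bounded_prob[of w] by linarith
      moreover from calculation have "q i < w" using q(2)[of i w] lt by auto
      ultimately show thesis using that[of "w - q i"] by (simp add: t_def)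
    qed
    have lim: "(\<lambda>k. exp (- (real k * c))) \<longlonglongrightarrow> 0" using c(1) by real_asymp
    show ?thesis
    proof (rule tendsto_sandwich[OF _ _ tendsto_const lim])
      show "eventually (\<lambda>k. exp (- (real k * (w - t k i))) \<le> exp (- (real k * c))) sequentially"
        using c(2) by eventually_elim (simp add: mult_left_mono)
    qed simp
  qed
  have above: "(\<lambda>k. exp (real k * (w - t k i))) \<longlonglongrightarrow> 0" if lt: "cdf M w < P i" for w i
  proof -
    obtain c where c: "0 < c" "eventually (\<lambda>k. w - t k i \<le> - c) sequentially"
    proof (cases "1 \<le> P i")
      case True
      have "eventually (\<lambda>k. w + 1 \<le> real k) sequentially"
        by (rule eventually_sequentiallyI[of "nat \<lceil>w + 1\<rceil>"]) linarith
      then have "eventually (\<lambda>k. w - t k i \<le> - 1) sequentially"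
        by eventually_elim (use True in \<open>simp add: t_def\<close>)
      then show thesis using that[of 1] by simp
    next
      case False
      moreover have "0 < P i" using lt cdf_nonneg[of w] by linarith
      moreover from calculation have "w < q i"
        using q(1)[of i] cdf_nondecreasing[of "q i" w] lt by force
      ultimately show thesis using that[of "q i - w"] by (simp add: t_def)
    qed
    have lim: "(\<lambda>k. exp (- (real k * c))) \<longlonglongrightarrow> 0" using c(1) by real_asymp
    show ?thesis
    proof (rule tendsto_sandwich[OF _ _ tendsto_const lim])
      show "eventually (\<lambda>k. exp (real k * (w - t k i)) \<le> exp (- (real k * c))) sequentially"
        using c(2)
      proof eventually_elim
        case (elim k)
        then have "real k * (w - t k i) \<le> real k * (- c)" by (intro mult_left_mono) auto
        then show ?case by simp
      qed
    qed simp
  qed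
  define f where "f k w = 1 - exp (s k (J w) * w + r k (J w)) / (\<Sum>j\<le>n. exp (s k j * w + r k j))" for k w
  have f01: "0 \<le> f k w \<and> f k w \<le> 1" for k w
  proof -
    have "exp (s k (J w) * w + r k (J w)) \<le> (\<Sum>j\<le>n. exp (s k j * w + r k j))"
      using Jn by (intro member_le_sum) auto
    moreover have "0 < (\<Sum>j\<le>n. exp (s k j * w + r k j))" by (intro sum_pos) auto
    ultimately show ?thesis unfolding f_def by (auto simp: divide_le_eq_1 intro!: sum_nonneg)
  qed
  have lim: "(\<lambda>k. f k w) \<longlonglongrightarrow> 0" if w: "\<And>j. j \<le> Suc n \<Longrightarrow> cdf M w \<noteq> P j" for w
  proof -
    have lo: "P i < cdf M w" if "i \<le> J w" "1 \<le> i" for i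
    proof -
      have "\<not> J w \<le> i - 1" using that by simp
      then have "\<not> cdf M w \<le> P i" using J_le[of "i - 1" w] that Jn[of w] by simp
      then show ?thesis by simp
    qed
    \<comment> \<open>The definition of \<open>J\<close> yields only the weak inequality here;
      strictness comes from \<open>w\<close> avoiding the levels \<open>P i\<close>, hence almost
      surely.\<close>
    have hi: "cdf M w < P i" if "J w < i" "i \<le> n" for i
    proof -
      have "i - 1 \<le> n" "J w \<le> i - 1" using that by auto
      then have "cdf M w \<le> P i" using J_le[of "i - 1" w] that by simp
      then show ?thesis using w[of i] that by simp
    qed
    \<comment> \<open>Relative to the weight of \<open>J w\<close>, the weight of \<open>j\<close>
      is a product over the thresholds between \<open>j\<close> and \<open>J w\<close>. Each lies on
      the side of \<open>w\<close> that makes its factor vanish as \<open>k\<close> grows.\<close>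
    have one: "(\<lambda>k. exp ((s k j * w + r k j) - (s k (J w) * w + r k (J w)))) \<longlonglongrightarrow> (if j = J w then 1 else 0)"
      if "j \<le> n" for j
    proof -
      consider "j = J w" | "j < J w" | "J w < j" by linarith
      then show ?thesis
      proof cases
        case 2
        have eq: "exp ((s k j * w + r k j) - (s k (J w) * w + r k (J w)))
          = (\<Prod>i\<in>{Suc j..J w}. exp (- (real k * (w - t k i))))" for k
        proof -
          have "{1..J w} = {1..j} \<union> {Suc j..J w}" using 2 by auto
          then have "s k (J w) * w + r k (J w) = (s k j * w + r k j) + (\<Sum>i\<in>{Suc j..J w}. real k * (w - t k i))"
            unfolding v by (simp add: sum.union_disjoint)
          then show ?thesis by (simp add: exp_sum[symmetric] sum_negf)
        qed
        have "(\<lambda>k. \<Prod>i\<in>{Suc j..J w}. exp (- (real k * (w - t k i)))) \<longlonglongrightarrow> (\<Prod>i\<in>{Suc j..J w}. 0)"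
          using lo by (intro tendsto_prod below) auto
        then show ?thesis using 2 unfolding eq by (simp add: power_0_left)
      next
        case 3
        have eq: "exp ((s k j * w + r k j) - (s k (J w) * w + r k (J w)))
          = (\<Prod>i\<in>{Suc (J w)..j}. exp (real k * (w - t k i)))" for k
        proof -
          have "{1..j} = {1..J w} \<union> {Suc (J w)..j}" using 3 by auto
          then have "s k j * w + r k j = (s k (J w) * w + r k (J w)) + (\<Sum>i\<in>{Suc (J w)..j}. real k * (w - t k i))"
            unfolding v by (simp add: sum.union_disjoint)
          then show ?thesis by (simp add: exp_sum[symmetric])
        qed
        have "(\<lambda>k. \<Prod>i\<in>{Suc (J w)..j}. exp (real k * (w - t k i))) \<longlonglongrightarrow> (\<Prod>i\<in>{Suc (J w)..j}. 0)"
          using hi that by (intro tendsto_prod above) auto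
        then show ?thesis using 3 unfolding eq by (simp add: power_0_left)
      qed simp
    qed
    have "(\<lambda>k. \<Sum>j\<le>n. exp ((s k j * w + r k j) - (s k (J w) * w + r k (J w)))) \<longlonglongrightarrow> (\<Sum>j\<le>n. if j = J w then 1 else 0)"
      by (intro tendsto_sum one) auto
    also have "(\<Sum>j\<le>n. if j = J w then 1 else 0) = (1::real)" using Jn[of w] by simp
    finally have "(\<lambda>k. 1 - 1 / (\<Sum>j\<le>n. exp ((s k j * w + r k j) - (s k (J w) * w + r k (J w))))) \<longlonglongrightarrow> 1 - 1 / 1"
      by (intro tendsto_diff tendsto_divide tendsto_const) auto
    moreover have "f k w = 1 - 1 / (\<Sum>j\<le>n. exp ((s k j * w + r k j) - (s k (J w) * w + r k (J w))))" for k
      unfolding f_def exp_diff by (simp add: sum_divide_distrib[symmetric])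
    ultimately show ?thesis by simp
  qed
  have "AE w in M. \<forall>j\<in>{..Suc n}. cdf M w \<noteq> P j"
  proof (intro AE_finite_allI)
    fix j
    have "{w\<in>space M. cdf M w = P j} \<in> events" by measurable
    then have "AE w in M. w \<notin> {w. cdf M w = P j}"
      using measure_cdf_eq[OF M, of "P j"] by (intro AE_not_in) (auto simp: null_sets_def emeasure_eq_measure)
    then show "AE w in M. cdf M w \<noteq> P j" by simp
  qed simp
  then have ae: "AE w in M. (\<lambda>k. f k w) \<longlonglongrightarrow> 0"
    by eventually_elim (rule lim, auto)
  have [measurable]: "f k \<in> borel_measurable M" for k
    unfolding f_def by measurable
  have "(\<lambda>k. \<integral>w. f k w \<partial>M) \<longlonglongrightarrow> (\<integral>w. 0 \<partial>M)"
  proof (rule integral_dominated_convergence[where w = "\<lambda>_. 1"])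
    show "AE w in M. norm (f k w) \<le> 1" for k using f01 by simp
  qed (use ae in auto)
  then have "eventually (\<lambda>k. (\<integral>w. f k w \<partial>M) < e) sequentially"
    using \<open>0 < e\<close> by (intro order_tendstoD(2)) auto
  then obtain k where "(\<integral>w. f k w \<partial>M) < e" by (auto simp: eventually_sequentially)
  then show ?thesis using Jm Jn law unfolding f_def
    by (intro exI[of _ J] exI[of _ "s k"] exI[of _ "r k"]) auto
qed

section \<open>Discretisation of factors and covariates\<close>

lemma distr_PiM_componentwise:
  assumes "finite I" "\<And>i. prob_space (M i)" "\<And>i. prob_space (M' i)"
    and [measurable]: "\<And>i. f i \<in> measurable (M i) (M' i)"
  shows "distr (PiM I M) (PiM I M') (\<lambda>t. \<lambda>i\<in>I. f i (t i)) = PiM I (\<lambda>i. distr (M i) (M' i) (f i))"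
proof -
  interpret M: product_prob_space M by (rule product_prob_spaceI) (rule assms)
  have ND: "prob_space (distr (M i) (M' i) (f i))" for i
    using assms(2) by (intro prob_space.prob_space_distr) auto
  interpret D: product_prob_space "\<lambda>i. distr (M i) (M' i) (f i)"
    by (rule product_prob_spaceI) (rule ND)
  have sets_eq: "sets (PiM I (\<lambda>i. distr (M i) (M' i) (f i))) = sets (PiM I M')"
    by (intro sets_PiM_cong) auto
  show ?thesis
  proof (rule D.PiM_eqI)
    show "sets (distr (PiM I M) (PiM I M') (\<lambda>t. \<lambda>i\<in>I. f i (t i))) = sets (PiM I (\<lambda>i. distr (M i) (M' i) (f i)))"
      by (simp add: sets_eq)
    fix A assume A: "\<And>i. i \<in> I \<Longrightarrow> A i \<in> sets (distr (M i) (M' i) (f i))"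
    then have A': "\<And>i. i \<in> I \<Longrightarrow> A i \<in> sets (M' i)" by simp
    have AP: "Pi\<^sub>E I A \<in> sets (PiM I M')"
      using A' assms(1) by (intro sets_PiM_I_finite) auto
    have vim: "(\<lambda>t. \<lambda>i\<in>I. f i (t i)) -` Pi\<^sub>E I A \<inter> space (PiM I M) = Pi\<^sub>E I (\<lambda>i. f i -` A i \<inter> space (M i))"
      by (auto simp: space_PiM PiE_iff)
    have "emeasure (distr (PiM I M) (PiM I M') (\<lambda>t. \<lambda>i\<in>I. f i (t i))) (Pi\<^sub>E I A)
        = emeasure (PiM I M) (Pi\<^sub>E I (\<lambda>i. f i -` A i \<inter> space (M i)))"
      using AP by (subst emeasure_distr) (auto simp: vim)
    also have "\<dots> = (\<Prod>i\<in>I. emeasure (M i) (f i -` A i \<inter> space (M i)))"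
      using A' assms(1) by (intro M.emeasure_PiM) auto
    also have "\<dots> = (\<Prod>i\<in>I. emeasure (distr (M i) (M' i) (f i)) (A i))"
      using A' by (intro prod.cong refl) (simp add: emeasure_distr)
    finally show "emeasure (distr (PiM I M) (PiM I M') (\<lambda>t. \<lambda>i\<in>I. f i (t i))) (Pi\<^sub>E I A)
       = (\<Prod>i\<in>I. emeasure (distr (M i) (M' i) (f i)) (A i))" .
  qed (rule assms(1))
qed

text \<open>This exchanges \<open>\<Phi>\<close> for \<open>G\<close>. Both integrands see the
  factors only through their indices, so both integrals equal one integral over the same product of
  laws on the naturals; no map between the two factor spaces is needed.\<close>

lemma integral_PiM_equal_discrete_laws:
  fixes J :: "'i \<Rightarrow> 'a \<Rightarrow> nat" and K :: "'i \<Rightarrow> 'b \<Rightarrow> nat" and f :: "('i \<Rightarrow> nat) \<Rightarrow> real"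
  assumes I: "finite I" and M: "\<And>i. prob_space (M i)" "\<And>i. prob_space (M' i)"
    and J: "\<And>i. J i \<in> measurable (M i) (count_space UNIV)"
    and K: "\<And>i. K i \<in> measurable (M' i) (count_space UNIV)"
    and law: "\<And>i j. measure (M i) {w\<in>space (M i). J i w = j} = measure (M' i) {w\<in>space (M' i). K i w = j}"
    and f: "f \<in> borel_measurable (PiM I (\<lambda>_. count_space UNIV))"
  shows "(\<integral>t. f (\<lambda>i\<in>I. J i (t i)) \<partial>PiM I M) = (\<integral>t. f (\<lambda>i\<in>I. K i (t i)) \<partial>PiM I M')"
proof -
  note [measurable] = J K
  \<comment> \<open>The point mass at 0 stands in for \<open>count_space UNIV\<close>, whose
    measurable sets it has, because \<open>distr_PiM_componentwise\<close> asks for probability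
    spaces as targets.\<close>
  have R: "prob_space (return (count_space UNIV) (0::nat))" by (rule prob_space_return) simp
  have sC: "sets (PiM I (\<lambda>_::'i. return (count_space UNIV) (0::nat))) = sets (PiM I (\<lambda>_. count_space UNIV))"
    by (intro sets_PiM_cong) auto
  have f': "f \<in> borel_measurable (PiM I (\<lambda>_. return (count_space UNIV) (0::nat)))"
    using f measurable_cong_sets[OF sC refl] by blast
  have eq: "distr (M i) (return (count_space UNIV) 0) (J i) = distr (M' i) (return (count_space UNIV) 0) (K i)" for i
  proof (rule measure_eqI_countable[of _ UNIV])
    interpret M: prob_space "M i" by (rule M)
    interpret M': prob_space "M' i" by (rule M)
    fix j :: nat
    have "J i -` {j} \<inter> space (M i) = {w\<in>space (M i). J i w = j}"
      "K i -` {j} \<inter> space (M' i) = {w\<in>space (M' i). K i w = j}" by auto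
    then show "emeasure (distr (M i) (return (count_space UNIV) 0) (J i)) {j} =
        emeasure (distr (M' i) (return (count_space UNIV) 0) (K i)) {j}"
      using law[of i j] by (simp add: emeasure_distr M.emeasure_eq_measure M'.emeasure_eq_measure)
  qed auto
  have mJ: "(\<lambda>t. \<lambda>i\<in>I. J i (t i)) \<in> measurable (PiM I M) (PiM I (\<lambda>_. return (count_space UNIV) 0))"
    and mK: "(\<lambda>t. \<lambda>i\<in>I. K i (t i)) \<in> measurable (PiM I M') (PiM I (\<lambda>_. return (count_space UNIV) 0))"
    using J K by (auto intro!: measurable_restrict measurable_compose[OF measurable_component_singleton])
  have "(\<integral>t. f (\<lambda>i\<in>I. J i (t i)) \<partial>PiM I M) =
      (\<integral>t. f t \<partial>distr (PiM I M) (PiM I (\<lambda>_. return (count_space UNIV) 0)) (\<lambda>t. \<lambda>i\<in>I. J i (t i)))"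
    by (rule integral_distr[OF mJ f', symmetric])
  also have "\<dots> = (\<integral>t. f t \<partial>distr (PiM I M') (PiM I (\<lambda>_. return (count_space UNIV) 0)) (\<lambda>t. \<lambda>i\<in>I. K i (t i)))"
    using distr_PiM_componentwise[OF I M(1) R, of J] distr_PiM_componentwise[OF I M(2) R, of K] by (simp add: eq)
  also have "\<dots> = (\<integral>t. f (\<lambda>i\<in>I. K i (t i)) \<partial>PiM I M')"
    by (rule integral_distr[OF mK f'])
  finally show ?thesis .
qed

text \<open>For finite \<open>'l\<close> the functions from \<open>'l\<close> to the naturals form a
  countable type, so singletons suffice. The gain is that every function of an index tuple becomes
  measurable, with nothing to check about it.\<close>

lemma measurable_finite_tuple:
  fixes h :: "'l::finite \<Rightarrow> 'a \<Rightarrow> nat"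
  assumes [measurable]: "\<And>l. h l \<in> measurable M (count_space UNIV)"
  shows "(\<lambda>t l. h l t) \<in> measurable M (count_space UNIV)"
proof -
  have "(\<lambda>t l. h l t) -` {b} \<inter> space M \<in> sets M" for b
  proof -
    have "(\<lambda>t l. h l t) -` {b} \<inter> space M = {t\<in>space M. \<forall>l\<in>UNIV. h l t = b l}" by auto
    also have "\<dots> \<in> sets M" by measurable
    finally show ?thesis .
  qed
  then show ?thesis by (subst measurable_count_space_eq2_countable) auto
qed

lemma measurable_vec_lambda:
  fixes h :: "'l::finite \<Rightarrow> 'a \<Rightarrow> real"
  assumes "\<And>l. h l \<in> borel_measurable M"
  shows "(\<lambda>t. \<chi> l. h l t) \<in> borel_measurable M"
proof (subst borel_measurable_euclidean_space, intro ballI)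
  fix b :: "real^'l" assume "b \<in> Basis"
  then obtain l where "b = axis l 1" by (auto simp: Basis_vec_def)
  then show "(\<lambda>t. (\<chi> l. h l t) \<bullet> b) \<in> borel_measurable M"
    using assms[of l] by (simp add: inner_axis)
qed

section \<open>Nearest points of a dense sequence\<close>

definition nearest :: "'a metric \<Rightarrow> (nat \<Rightarrow> 'a) \<Rightarrow> nat \<Rightarrow> 'a \<Rightarrow> nat" where
  "nearest m d n \<theta> = (LEAST i. i \<in> {..n} \<and> (\<forall>j\<in>{..n}. mdist m (d i) \<theta> \<le> mdist m (d j) \<theta>))"

lemma nearest:
  shows "nearest m d n \<theta> \<le> n" and "j \<le> n \<Longrightarrow> mdist m (d (nearest m d n \<theta>)) \<theta> \<le> mdist m (d j) \<theta>"
proof -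
  define i where "i = arg_min_on (\<lambda>i. mdist m (d i) \<theta>) {..n}"
  have "i \<in> {..n} \<and> (\<forall>j\<in>{..n}. mdist m (d i) \<theta> \<le> mdist m (d j) \<theta>)"
    using arg_min_least[of "{..n}" _ "\<lambda>i. mdist m (d i) \<theta>"] arg_min_if_finite(1)[of "{..n}" "\<lambda>i. mdist m (d i) \<theta>"]
    by (auto simp: i_def)
  then have "nearest m d n \<theta> \<in> {..n} \<and> (\<forall>j\<in>{..n}. mdist m (d (nearest m d n \<theta>)) \<theta> \<le> mdist m (d j) \<theta>)"
    unfolding nearest_def by (rule LeastI)
  then show "nearest m d n \<theta> \<le> n" "j \<le> n \<Longrightarrow> mdist m (d (nearest m d n \<theta>)) \<theta> \<le> mdist m (d j) \<theta>"
    by auto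
qed

lemma openin_mtopology_of_Pow: "{U. openin (mtopology_of m) U} \<subseteq> Pow (mspace m)"
proof
  fix U assume "U \<in> {U. openin (mtopology_of m) U}"
  then show "U \<in> Pow (mspace m)" using openin_subset[of "mtopology_of m" U] by simp
qed

lemma space_borel_of_metric: "space (borel_of_metric m) = mspace m"
  unfolding borel_of_metric_def by (rule space_measure_of) (rule openin_mtopology_of_Pow)

lemma openin_in_borel_of_metric: "openin (mtopology_of m) U \<Longrightarrow> U \<in> sets (borel_of_metric m)"
  unfolding borel_of_metric_def by (simp add: sets_measure_of[OF openin_mtopology_of_Pow])

lemma measurable_mdist_left:
  assumes sets: "sets G = sets (borel_of_metric m)" and "q \<in> mspace m"
  shows "mdist m q \<in> borel_measurable G"
proof (subst borel_measurable_iff_less, intro allI)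
  fix r
  have sp: "space G = mspace m" using sets_eq_imp_space_eq[OF sets] by (simp add: space_borel_of_metric)
  have "{w\<in>space G. mdist m q w < r} = mball_of m q r" using assms(2) by (auto simp: sp)
  moreover have "openin (mtopology_of m) (mball_of m q r)"
    by (simp add: mball_of_def mtopology_of_def Metric_space.openin_mball)
  ultimately show "{w\<in>space G. mdist m q w < r} \<in> sets G"
    using openin_in_borel_of_metric sets by simp
qed

text \<open>Only finitely many distances are compared, and \<open>LEAST\<close> resolves ties, so no
  measurable selection theorem is involved.\<close>

lemma measurable_nearest:
  assumes sets: "sets G = sets (borel_of_metric m)" and "\<And>i. d i \<in> mspace m"
  shows "nearest m d n \<in> measurable G (count_space UNIV)"
proof -
  have [measurable]: "mdist m (d i) \<in> borel_measurable G" for i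
    by (rule measurable_mdist_left) (rule assms)+
  show ?thesis unfolding nearest_def by measurable
qed

lemma nearest_eventually_close:
  assumes dense: "mspace m \<subseteq> mtopology_of m closure_of (range d)" and "\<And>i. d i \<in> mspace m"
    and "\<theta> \<in> mspace m" "0 < e"
  shows "eventually (\<lambda>n. mdist m (d (nearest m d n \<theta>)) \<theta> < e) sequentially"
proof -
  have "\<theta> \<in> mtopology_of m closure_of (range d)" using assms by blast
  then obtain i where i: "mdist m \<theta> (d i) < e"
    using \<open>0 < e\<close> by (auto simp: mtopology_of_def Metric_space.metric_closure_of Metric_space.in_mball)
  then have "mdist m (d i) \<theta> < e" by (simp add: mdist_commute)
  then have "mdist m (d (nearest m d n \<theta>)) \<theta> < e" if "i \<le> n" for n
    using nearest(2)[OF that, of m d \<theta>] by linarith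
  then show ?thesis unfolding eventually_sequentially by blast
qed

lemma separable_space_dense_sequence:
  assumes "separable_space Z" "topspace Z \<noteq> {}"
  obtains d :: "nat \<Rightarrow> 'a" where "\<And>i. d i \<in> topspace Z" "topspace Z \<subseteq> Z closure_of (range d)"
proof -
  obtain C where C: "countable C" "C \<subseteq> topspace Z" "Z closure_of C = topspace Z"
    using assms(1) unfolding separable_space_def by blast
  have "C \<noteq> {}"
  proof
    assume "C = {}"
    with C(3) have "topspace Z = {}" by (simp only: closure_of_empty)
    with assms(2) show False by contradiction
  qed
  then have r: "range (from_nat_into C) = C" using C by (simp add: range_from_nat_into)
  show thesis
  proof (rule that[of "from_nat_into C"])
    show "from_nat_into C i \<in> topspace Z" for i using C(2) r by blast
    show "topspace Z \<subseteq> Z closure_of (range (from_nat_into C))" using C(3) r by simp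
  qed
qed

section \<open>Gaussian weights over covariate sites\<close>

definition soft_voronoi :: "(nat \<Rightarrow> real^'p) \<Rightarrow> nat \<Rightarrow> nat \<Rightarrow> real^'p \<Rightarrow> real" where
  "soft_voronoi a n i x = exp (real n * (2 * (a i \<bullet> x) - a i \<bullet> a i)) /
     (\<Sum>j\<le>n. exp (real n * (2 * (a j \<bullet> x) - a j \<bullet> a j)))"

lemma sum_exp_pos: "0 < (\<Sum>j\<le>n::nat. exp (f j) :: real)"
  by (intro sum_pos) auto

lemma soft_voronoi_nonneg: "0 \<le> soft_voronoi a n i x"
  unfolding soft_voronoi_def by (intro divide_nonneg_pos sum_exp_pos) simp

lemma sum_soft_voronoi: "(\<Sum>i\<le>n. soft_voronoi a n i x) = 1"
  unfolding soft_voronoi_def sum_divide_distrib[symmetric] using sum_exp_pos[of "\<lambda>j. real n * (2 * (a j \<bullet> x) - a j \<bullet> a j)" n] by simp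

text \<open>The exponent is \<open>n * (norm x)\<^sup>2 - n * (dist x (a i))\<^sup>2\<close>, so the weights favour the
  sites closest to \<open>x\<close>.\<close>

lemma soft_voronoi_concentrates:
  fixes a :: "nat \<Rightarrow> real^'p"
  assumes K: "compact K" "K \<subseteq> closure (range a)" and "0 < \<delta>" "0 < e"
  shows "eventually (\<lambda>n. \<forall>x\<in>K. (\<Sum>i\<in>{i\<in>{..n}. \<delta> \<le> dist (a i) x}. soft_voronoi a n i x) < e) sequentially"
proof -
  have cover: "K \<subseteq> (\<Union>j\<in>UNIV. ball (a j) (\<delta> / 2))"
  proof
    fix x assume "x \<in> K"
    then have "x \<in> closure (range a)" using K by blast
    then obtain j where "dist (a j) x < \<delta> / 2"
      unfolding closure_approachable using \<open>0 < \<delta>\<close> by (auto dest: spec[of _ "\<delta> / 2"])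
    then show "x \<in> (\<Union>j\<in>UNIV. ball (a j) (\<delta> / 2))" by auto
  qed
  obtain D where D: "D \<subseteq> UNIV" "finite D" "K \<subseteq> (\<Union>j\<in>D. ball (a j) (\<delta> / 2))"
    by (rule compactE_image[OF K(1) _ cover]) simp
  have m: "j \<le> Max D" if "j \<in> D" for j using D(2) that by (rule Max_ge)
  \<comment> \<open>Every \<open>x\<close> in \<open>K\<close> has a site within
    \<open>\<delta> / 2\<close> among finitely many. Against it, a site at distance at least
    \<open>\<delta>\<close> loses \<open>n\<close> times \<delta> squared minus a quarter of
    \<delta> squared in the exponent; this is the origin of \<open>3 / 4\<close>. The factor
    \<open>real n + 1\<close> counts the sites.\<close>
  have "(\<lambda>n. (real n + 1) * exp (- (real n * (3 / 4 * \<delta>\<^sup>2)))) \<longlonglongrightarrow> 0"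
    using \<open>0 < \<delta>\<close> by real_asymp
  then have "eventually (\<lambda>n. (real n + 1) * exp (- (real n * (3 / 4 * \<delta>\<^sup>2))) < e) sequentially"
    using \<open>0 < e\<close> by (rule order_tendstoD(2))
  then show ?thesis
    using eventually_ge_at_top[of "Max D"]
  proof eventually_elim
    case (elim n)
    show ?case
    proof
      fix x assume "x \<in> K"
      then obtain j where j: "j \<in> D" "dist (a j) x < \<delta> / 2" using D(3) by auto
      then have jn: "j \<le> n" using m elim(2) by force
      define f where "f i = real n * (2 * (a i \<bullet> x) - a i \<bullet> a i)" for i
      have f: "f i = real n * (x \<bullet> x) - real n * (dist (a i) x)\<^sup>2" for i
        by (simp add: f_def dist_norm power2_norm_eq_inner algebra_simps inner_commute)
      have far: "soft_voronoi a n i x \<le> exp (- (real n * (3 / 4 * \<delta>\<^sup>2)))" if "\<delta> \<le> dist (a i) x" for i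
      proof -
        have "exp (f j) \<le> (\<Sum>j\<le>n. exp (f j))" using jn by (intro member_le_sum) auto
        then have "soft_voronoi a n i x \<le> exp (f i) / exp (f j)"
          unfolding soft_voronoi_def f_def[symmetric] by (intro divide_left_mono) (auto simp: sum_exp_pos)
        also have "\<dots> = exp (- (real n * ((dist (a i) x)\<^sup>2 - (dist (a j) x)\<^sup>2)))"
          by (simp add: f exp_diff[symmetric] algebra_simps)
        also have "\<dots> \<le> exp (- (real n * (3 / 4 * \<delta>\<^sup>2)))"
        proof -
          have "\<delta>\<^sup>2 \<le> (dist (a i) x)\<^sup>2" using that \<open>0 < \<delta>\<close> by (intro power_mono) auto
          moreover have "(dist (a j) x)\<^sup>2 \<le> (\<delta> / 2)\<^sup>2" using j by (intro power_mono) auto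
          ultimately have "3 / 4 * \<delta>\<^sup>2 \<le> (dist (a i) x)\<^sup>2 - (dist (a j) x)\<^sup>2" by (simp add: power_divide)
          then have "real n * (3 / 4 * \<delta>\<^sup>2) \<le> real n * ((dist (a i) x)\<^sup>2 - (dist (a j) x)\<^sup>2)"
            by (intro mult_left_mono) auto
          then show ?thesis by (simp only: exp_le_cancel_iff neg_le_iff_le)
        qed
        finally show ?thesis .
      qed
      have "(\<Sum>i\<in>{i\<in>{..n}. \<delta> \<le> dist (a i) x}. soft_voronoi a n i x)
          \<le> (\<Sum>i\<in>{i\<in>{..n}. \<delta> \<le> dist (a i) x}. exp (- (real n * (3 / 4 * \<delta>\<^sup>2))))"
        by (intro sum_mono far) auto
      also have "\<dots> \<le> (\<Sum>i\<le>n. exp (- (real n * (3 / 4 * \<delta>\<^sup>2))))"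
        by (intro sum_mono2) auto
      also have "\<dots> < e" using elim(1) by (simp add: add.commute)
      finally show "(\<Sum>i\<in>{i\<in>{..n}. \<delta> \<le> dist (a i) x}. soft_voronoi a n i x) < e" .
    qed
  qed
qed

text \<open>If uniformity failed, bad arguments chosen one for each \<open>n\<close> would form a
  sequence violating the premise. Testing along sequences suits dominated convergence, whose
  integrands may then depend on \<open>n\<close> through the arguments as well.\<close>

lemma uniform_limit_sequentiallyI:
  fixes f :: "nat \<Rightarrow> 'a \<Rightarrow> real"
  assumes "\<And>z. (\<And>n. z n \<in> S) \<Longrightarrow> (\<lambda>n. f n (z n) - l (z n)) \<longlonglongrightarrow> 0"
  shows "uniform_limit S f l sequentially"
proof (rule uniform_limitI, rule ccontr)
  fix e :: real assume e: "0 < e" and "\<not> eventually (\<lambda>n. \<forall>x\<in>S. dist (f n x) (l x) < e) sequentially"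
  then have bad: "\<And>m. \<exists>n\<ge>m. \<exists>x\<in>S. e \<le> dist (f n x) (l x)"
    unfolding eventually_sequentially not_ex not_all by (meson not_le)
  then obtain x0 where x0: "x0 \<in> S" by blast
  \<comment> \<open>Indices without a bad argument receive the default \<open>x0\<close>, so that
    the whole sequence stays in \<open>S\<close>.\<close>
  define z where "z n = (if \<exists>x\<in>S. e \<le> dist (f n x) (l x) then SOME x. x \<in> S \<and> e \<le> dist (f n x) (l x) else x0)" for n
  have z: "z n \<in> S \<and> ((\<exists>x\<in>S. e \<le> dist (f n x) (l x)) \<longrightarrow> e \<le> dist (f n (z n)) (l (z n)))" for n
    using x0 someI_ex[of "\<lambda>x. x \<in> S \<and> e \<le> dist (f n x) (l x)"] unfolding z_def Bex_def by auto
  have "(\<lambda>n. f n (z n) - l (z n)) \<longlonglongrightarrow> 0" using z by (intro assms) auto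
  then have "eventually (\<lambda>n. dist (f n (z n) - l (z n)) 0 < e) sequentially"
    using e by (rule tendstoD)
  then obtain m where "\<And>n. m \<le> n \<Longrightarrow> dist (f n (z n)) (l (z n)) < e"
    unfolding eventually_sequentially by (auto simp: dist_real_def)
  moreover obtain n where "m \<le> n" "\<exists>x\<in>S. e \<le> dist (f n x) (l x)" using bad by blast
  ultimately show False using z[of n] by force
qed

section \<open>Kernels of generalized mixed effects models\<close>

lemma mmoe_df_bounds:
  assumes F0_df: "\<And>\<psi>. \<psi> \<in> \<Psi>0 \<Longrightarrow> distribution_function (\<lambda>y. F0 y \<psi>)" and "F \<in> mmoe_dfs F0 \<Psi>0"
  shows "0 \<le> F y x w" "F y x w \<le> 1" "F y x \<in> borel_measurable borel"
proof -
  obtain g \<alpha>0 \<alpha> \<beta> \<psi> where F: "F = (\<lambda>y x w. \<Sum>j\<in>{1..g}. gate g \<alpha>0 \<alpha> \<beta> j x w * F0 y (\<psi> j))"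
    and g: "1 \<le> g" and \<psi>: "\<And>j. j \<in> {1..g} \<Longrightarrow> \<psi> j \<in> \<Psi>0"
    using assms(2) unfolding mmoe_dfs_def by blast
  have pos: "0 < (\<Sum>j'\<in>{1..g}. exp (\<alpha>0 j' + \<alpha> j' \<bullet> x + \<beta> j' \<bullet> w))" for x w
    using g by (intro sum_pos) auto
  have gate: "0 \<le> gate g \<alpha>0 \<alpha> \<beta> j x w" for j x w
    unfolding gate_def using pos by (intro divide_nonneg_pos) auto
  have sum_gate: "(\<Sum>j\<in>{1..g}. gate g \<alpha>0 \<alpha> \<beta> j x w) = 1" for x w
    unfolding gate_def sum_divide_distrib[symmetric] using pos[of x w] by simp
  have F01: "0 \<le> F0 y (\<psi> j)" "F0 y (\<psi> j) \<le> 1" if j: "j \<in> {1..g}" for y j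
  proof -
    obtain M where "prob_space M" "(\<lambda>y. F0 y (\<psi> j)) = orthant_cdf M"
      using F0_df[OF \<psi>[OF j]] unfolding distribution_function_def by blast
    then show "0 \<le> F0 y (\<psi> j)" "F0 y (\<psi> j) \<le> 1"
      by (auto simp: fun_eq_iff orthant_cdf_def prob_space.prob_le_1)
  qed
  show "0 \<le> F y x w" unfolding F using gate F01 by (intro sum_nonneg mult_nonneg_nonneg) auto
  have "F y x w \<le> (\<Sum>j\<in>{1..g}. gate g \<alpha>0 \<alpha> \<beta> j x w * 1)"
    unfolding F using gate F01 by (intro sum_mono mult_left_mono) auto
  then show "F y x w \<le> 1" using sum_gate by simp
  show "F y x \<in> borel_measurable borel" unfolding F gate_def by measurable
qed

text \<open>A union bound for weights: the weight missed by a product of gates is at most the total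
  missed by the single gates.\<close>

lemma one_minus_prod_le_sum:
  fixes f :: "'a \<Rightarrow> real"
  assumes "finite A" "\<And>i. i \<in> A \<Longrightarrow> 0 \<le> f i" "\<And>i. i \<in> A \<Longrightarrow> f i \<le> 1"
  shows "1 - (\<Prod>i\<in>A. f i) \<le> (\<Sum>i\<in>A. 1 - f i)"
proof -
  have "norm ((\<Prod>i\<in>A. 1) - (\<Prod>i\<in>A. f i)) \<le> (\<Sum>i\<in>A. norm (1 - f i))"
    using assms by (intro norm_prod_diff) auto
  also have "\<dots> = (\<Sum>i\<in>A. 1 - f i)" using assms by (intro sum.cong) auto
  finally show ?thesis by simp
qed

locale mixed_effects_kernel =
  fixes X :: "(real^'p) set" and \<Theta> :: "'l::finite \<Rightarrow> 'a metric"
    and H :: "real^'k \<Rightarrow> real^'p \<Rightarrow> ('l \<Rightarrow> 'a) \<Rightarrow> real"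
  assumes H_df: "\<And>x \<theta>. x \<in> X \<Longrightarrow> (\<And>l. \<theta> l \<in> mspace (\<Theta> l)) \<Longrightarrow> distribution_function (\<lambda>y. H y x \<theta>)"
    and H_cont: "continuous_map
       (prod_topology euclidean
         (prod_topology (top_of_set X) (product_topology (\<lambda>l. mtopology_of (\<Theta> l)) UNIV)))
       euclideanreal (\<lambda>(y, x, \<theta>). H y x \<theta>)"
begin

text \<open>There are finitely many levels, so the radii of a basic neighbourhood in the product
  topology have a positive minimum, and one \<delta> serves all coordinates.\<close>

lemma eps_delta:
  assumes "x \<in> X" "\<And>l. \<theta> l \<in> mspace (\<Theta> l)" "0 < e"
  obtains \<delta> where "0 < \<delta>"
    "\<And>y' x' \<theta>'. dist y' y < \<delta> \<Longrightarrow> x' \<in> X \<Longrightarrow> dist x' x < \<delta> \<Longrightarrow> (\<And>l. \<theta>' l \<in> mspace (\<Theta> l)) \<Longrightarrow>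
       (\<And>l. mdist (\<Theta> l) (\<theta> l) (\<theta>' l) < \<delta>) \<Longrightarrow> \<bar>H y' x' \<theta>' - H y x \<theta>\<bar> < e"
proof -
  let ?P = "product_topology (\<lambda>l. mtopology_of (\<Theta> l)) UNIV"
  let ?T = "prod_topology (euclidean :: (real^'k) topology) (prod_topology (top_of_set X) ?P)"
  define W where "W = {p \<in> topspace ?T. (\<lambda>(y, x, \<theta>). H y x \<theta>) p \<in> ball (H y x \<theta>) e}"
  have W: "openin ?T W"
    unfolding W_def by (rule openin_continuous_map_preimage[OF H_cont]) auto
  have inW: "(y, x, \<theta>) \<in> W" using assms by (auto simp: W_def)
  obtain U V where UV: "openin euclidean U" "openin (prod_topology (top_of_set X) ?P) V" "y \<in> U" "(x, \<theta>) \<in> V" "U \<times> V \<subseteq> W"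
    using openin_prod_topology_alt[THEN iffD1, OF W, rule_format, OF inW] by (elim exE conjE)
  obtain A B where AB: "openin (top_of_set X) A" "openin ?P B" "x \<in> A" "\<theta> \<in> B" "A \<times> B \<subseteq> V"
    using openin_prod_topology_alt[THEN iffD1, OF UV(2), rule_format, OF UV(4)] by (elim exE conjE)
  obtain C where C: "\<And>l. openin (mtopology_of (\<Theta> l)) (C l)" "\<theta> \<in> Pi\<^sub>E UNIV C" "Pi\<^sub>E UNIV C \<subseteq> B"
    using openin_product_topology_alt[THEN iffD1, OF AB(2), rule_format, OF AB(4)] by auto
  obtain d1 where d1: "0 < d1" "\<And>y'. dist y' y < d1 \<Longrightarrow> y' \<in> U" using UV(1,3) by (auto simp: open_dist)
  obtain d2 where d2: "0 < d2" "\<And>x'. x' \<in> X \<Longrightarrow> dist x' x < d2 \<Longrightarrow> x' \<in> A"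
    using AB(1,3) unfolding openin_euclidean_subtopology_iff by blast
  have "\<exists>r>0. Metric_space.mball (mspace (\<Theta> l)) (mdist (\<Theta> l)) (\<theta> l) r \<subseteq> C l" for l
    using C(1)[of l] C(2) by (auto simp: mtopology_of_def Metric_space.openin_mtopology[OF Metric_space_mspace_mdist] PiE_iff)
  then obtain r where r: "\<And>l. 0 < r l" "\<And>l. Metric_space.mball (mspace (\<Theta> l)) (mdist (\<Theta> l)) (\<theta> l) (r l) \<subseteq> C l"
    by metis
  define \<delta> where "\<delta> = min d1 (min d2 (Min (range r)))"
  show thesis
  proof (rule that[of \<delta>])
    show "0 < \<delta>" using d1 d2 r by (simp add: \<delta>_def)
    fix y' x' \<theta>' assume *: "dist y' y < \<delta>" "x' \<in> X" "dist x' x < \<delta>" "\<And>l. \<theta>' l \<in> mspace (\<Theta> l)"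
       "\<And>l. mdist (\<Theta> l) (\<theta> l) (\<theta>' l) < \<delta>"
    have "y' \<in> U" "x' \<in> A" using * by (auto intro: d1 d2 simp: \<delta>_def)
    moreover have "\<theta>' l \<in> C l" for l
    proof -
      have "Min (range r) \<le> r l" by (intro Min_le) auto
      then have "mdist (\<Theta> l) (\<theta> l) (\<theta>' l) < r l" using *(5)[of l] by (auto simp: \<delta>_def)
      then have "\<theta>' l \<in> Metric_space.mball (mspace (\<Theta> l)) (mdist (\<Theta> l)) (\<theta> l) (r l)"
        using *(4) assms(2) by (simp add: Metric_space.in_mball[OF Metric_space_mspace_mdist])
      then show ?thesis using r(2) by blast
    qed
    then have "\<theta>' \<in> B" using C(3) by auto
    ultimately have "(y', x', \<theta>') \<in> W" using UV(5) AB(5) by blast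
    then show "\<bar>H y' x' \<theta>' - H y x \<theta>\<bar> < e" by (auto simp: W_def dist_real_def abs_minus_commute)
  qed
qed

lemma H_orthant_monotone:
  assumes "x \<in> X" "\<And>l. \<theta> l \<in> mspace (\<Theta> l)"
  shows "orthant_monotone (\<lambda>y. H y x \<theta>)"
  using H_df[OF assms] orthant_monotone_orthant_cdf unfolding distribution_function_def by metis

lemma H_continuous_in_y:
  assumes "x \<in> X" "\<And>l. \<theta> l \<in> mspace (\<Theta> l)"
  shows "continuous_on UNIV (\<lambda>y. H y x \<theta>)"
  unfolding continuous_on_iff
proof (intro ballI allI impI)
  fix y and e :: real assume "0 < e"
  then obtain \<delta> where \<delta>: "0 < \<delta>" "\<And>y' x' \<theta>'. dist y' y < \<delta> \<Longrightarrow> x' \<in> X \<Longrightarrow> dist x' x < \<delta> \<Longrightarrow> (\<And>l. \<theta>' l \<in> mspace (\<Theta> l)) \<Longrightarrow>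
       (\<And>l. mdist (\<Theta> l) (\<theta> l) (\<theta>' l) < \<delta>) \<Longrightarrow> \<bar>H y' x' \<theta>' - H y x \<theta>\<bar> < e"
    using eps_delta[OF assms] by metis
  have "mdist (\<Theta> l) (\<theta> l) (\<theta> l) < \<delta>" for l using \<delta>(1) assms(2) mdist_zero by metis
  then have "dist (H y' x \<theta>) (H y x \<theta>) < e" if "dist y' y < \<delta>" for y'
    using \<delta>(2)[OF that assms(1) _ assms(2)] \<delta>(1) by (simp add: dist_real_def)
  then show "\<exists>d>0. \<forall>x'\<in>UNIV. dist x' y < d \<longrightarrow> dist (H x' x \<theta>) (H y x \<theta>) < e" using \<delta>(1) by blast
qed

text \<open>The perturbed kernels are again distribution functions, so closeness at the finitely
  many points of the Polya argument extends to all \<open>y\<close>. Joint continuity is invoked at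
  those points only.\<close>

lemma uniform_in_y:
  assumes "x \<in> X" "\<And>l. \<theta> l \<in> mspace (\<Theta> l)" "0 < e"
  obtains \<delta> where "0 < \<delta>"
    "\<And>x' \<theta>' y. x' \<in> X \<Longrightarrow> dist x' x < \<delta> \<Longrightarrow> (\<And>l. \<theta>' l \<in> mspace (\<Theta> l)) \<Longrightarrow>
       (\<And>l. mdist (\<Theta> l) (\<theta> l) (\<theta>' l) < \<delta>) \<Longrightarrow> \<bar>H y x' \<theta>' - H y x \<theta>\<bar> < e"
proof -
  obtain Y d where Y: "finite Y" "0 < d" 
    "\<And>F' y. orthant_monotone F' \<Longrightarrow> (\<And>y. y \<in> Y \<Longrightarrow> \<bar>F' y - H y x \<theta>\<bar> < d) \<Longrightarrow> \<bar>F' y - H y x \<theta>\<bar> < e"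
    using distribution_function_determined_on_finite_set[OF H_df[OF assms(1,2)] H_continuous_in_y[OF assms(1,2)] assms(3)]
    by blast
  have "\<exists>\<delta>>0. \<forall>x' \<theta>'. x' \<in> X \<longrightarrow> dist x' x < \<delta> \<longrightarrow> (\<forall>l. \<theta>' l \<in> mspace (\<Theta> l)) \<longrightarrow>
      (\<forall>l. mdist (\<Theta> l) (\<theta> l) (\<theta>' l) < \<delta>) \<longrightarrow> \<bar>H y x' \<theta>' - H y x \<theta>\<bar> < d" for y
  proof -
    obtain \<delta> where "0 < \<delta>" "\<And>y' x' \<theta>'. dist y' y < \<delta> \<Longrightarrow> x' \<in> X \<Longrightarrow> dist x' x < \<delta> \<Longrightarrow> (\<And>l. \<theta>' l \<in> mspace (\<Theta> l)) \<Longrightarrow>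
       (\<And>l. mdist (\<Theta> l) (\<theta> l) (\<theta>' l) < \<delta>) \<Longrightarrow> \<bar>H y' x' \<theta>' - H y x \<theta>\<bar> < d"
      using eps_delta[OF assms(1,2) Y(2)] by metis
    then show ?thesis by (intro exI[of _ \<delta>]) auto
  qed
  then obtain \<delta> where \<delta>: "\<And>y. 0 < \<delta> y" "\<And>y x' \<theta>'. x' \<in> X \<Longrightarrow> dist x' x < \<delta> y \<Longrightarrow> (\<And>l. \<theta>' l \<in> mspace (\<Theta> l)) \<Longrightarrow>
      (\<And>l. mdist (\<Theta> l) (\<theta> l) (\<theta>' l) < \<delta> y) \<Longrightarrow> \<bar>H y x' \<theta>' - H y x \<theta>\<bar> < d"
    by metis
  \<comment> \<open>The entry 1 keeps the minimum meaningful when \<open>Y\<close> is empty.\<close>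
  define m where "m = Min (insert 1 (\<delta> ` Y))"
  have m: "m \<le> \<delta> y" if "y \<in> Y" for y unfolding m_def using Y(1) that by (intro Min_le) auto
  show thesis
  proof (rule that[of m])
    show "0 < m" unfolding m_def using Y(1) \<delta>(1) by (subst Min_gr_iff) auto
    fix x' \<theta>' y
    assume *: "x' \<in> X" "dist x' x < m" "\<And>l. \<theta>' l \<in> mspace (\<Theta> l)" "\<And>l. mdist (\<Theta> l) (\<theta> l) (\<theta>' l) < m"
    show "\<bar>H y x' \<theta>' - H y x \<theta>\<bar> < e"
    proof (rule Y(3)[OF H_orthant_monotone[OF *(1,3)]])
      fix y assume "y \<in> Y"
      then show "\<bar>H y x' \<theta>' - H y x \<theta>\<bar> < d"
        using m *(2,4) by (intro \<delta>(2) *(1,3)) (auto intro: less_le_trans)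
    qed
  qed
qed

text \<open>A Lebesgue number argument with half radii, in \<open>x\<close> alone: \<theta> stays
  fixed because the later limit is pointwise in the factors. The point \<open>x'\<close> ranges over
  \<open>X\<close> rather than \<open>K\<close>, since the sites that approximate \<open>x\<close>
  need not lie in \<open>K\<close>.\<close>

lemma uniform_on_compact:
  assumes K: "compact K" "K \<subseteq> X" and \<theta>: "\<And>l. \<theta> l \<in> mspace (\<Theta> l)" and "0 < e"
  obtains \<delta> where "0 < \<delta>"
    "\<And>x x' \<theta>' y. x \<in> K \<Longrightarrow> x' \<in> X \<Longrightarrow> dist x' x < \<delta> \<Longrightarrow> (\<And>l. \<theta>' l \<in> mspace (\<Theta> l)) \<Longrightarrow>
       (\<And>l. mdist (\<Theta> l) (\<theta> l) (\<theta>' l) < \<delta>) \<Longrightarrow> \<bar>H y x' \<theta>' - H y x \<theta>\<bar> < e"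
proof -
  have "\<exists>\<delta>>0. \<forall>x' \<theta>' y. x' \<in> X \<longrightarrow> dist x' x < \<delta> \<longrightarrow> (\<forall>l. \<theta>' l \<in> mspace (\<Theta> l)) \<longrightarrow>
      (\<forall>l. mdist (\<Theta> l) (\<theta> l) (\<theta>' l) < \<delta>) \<longrightarrow> \<bar>H y x' \<theta>' - H y x \<theta>\<bar> < e / 2" if "x \<in> K" for x
  proof -
    have "x \<in> X" "0 < e / 2" using that K(2) \<open>0 < e\<close> by auto
    then obtain \<delta> where "0 < \<delta>" "\<And>x' \<theta>' y. x' \<in> X \<Longrightarrow> dist x' x < \<delta> \<Longrightarrow> (\<And>l. \<theta>' l \<in> mspace (\<Theta> l)) \<Longrightarrow>
       (\<And>l. mdist (\<Theta> l) (\<theta> l) (\<theta>' l) < \<delta>) \<Longrightarrow> \<bar>H y x' \<theta>' - H y x \<theta>\<bar> < e / 2"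
      using uniform_in_y[OF _ \<theta>, of x "e / 2"] by metis
    then show ?thesis by (intro exI[of _ \<delta>]) auto
  qed
  then obtain \<delta> where \<delta>: "\<And>x. x \<in> K \<Longrightarrow> 0 < \<delta> x"
    "\<And>x x' \<theta>' y. x \<in> K \<Longrightarrow> x' \<in> X \<Longrightarrow> dist x' x < \<delta> x \<Longrightarrow> (\<And>l. \<theta>' l \<in> mspace (\<Theta> l)) \<Longrightarrow>
      (\<And>l. mdist (\<Theta> l) (\<theta> l) (\<theta>' l) < \<delta> x) \<Longrightarrow> \<bar>H y x' \<theta>' - H y x \<theta>\<bar> < e / 2"
    by metis
  have cover: "K \<subseteq> (\<Union>x\<in>K. ball x (\<delta> x / 2))" using \<delta>(1) by force
  obtain D where D: "D \<subseteq> K" "finite D" "K \<subseteq> (\<Union>x\<in>D. ball x (\<delta> x / 2))"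
    by (rule compactE_image[OF K(1) _ cover]) simp
  define m where "m = Min (insert 1 ((\<lambda>x. \<delta> x / 2) ` D))"
  have m: "m \<le> \<delta> x / 2" if "x \<in> D" for x unfolding m_def using D(2) that by (intro Min_le) auto
  show thesis
  proof (rule that[of m])
    show "0 < m" unfolding m_def using D \<delta>(1) by (subst Min_gr_iff) auto
    fix x x' \<theta>' y
    assume *: "x \<in> K" "x' \<in> X" "dist x' x < m" "\<And>l. \<theta>' l \<in> mspace (\<Theta> l)" "\<And>l. mdist (\<Theta> l) (\<theta> l) (\<theta>' l) < m"
    obtain z where z: "z \<in> D" "dist z x < \<delta> z / 2" using D(3) *(1) by auto
    have zK: "z \<in> K" using z D by blast
    have d0: "0 < \<delta> z" using \<delta>(1)[OF zK] .
    have "dist x' z < \<delta> z" using dist_triangle[of x' z x] *(3) m[OF z(1)] z(2) by (simp add: dist_commute)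
    moreover have "mdist (\<Theta> l) (\<theta> l) (\<theta>' l) < \<delta> z" for l using *(5)[of l] m[OF z(1)] d0 by linarith
    ultimately have 1: "\<bar>H y x' \<theta>' - H y z \<theta>\<bar> < e / 2" using \<delta>(2)[OF zK *(2)] *(4) by blast
    have "dist x z < \<delta> z" using z(2) d0 by (simp add: dist_commute)
    moreover have "mdist (\<Theta> l) (\<theta> l) (\<theta> l) < \<delta> z" for l using d0 \<theta> mdist_zero by metis
    ultimately have "\<bar>H y x \<theta> - H y z \<theta>\<bar> < e / 2" using \<delta>(2)[OF zK] *(1) K(2) \<theta> by blast
    with 1 show "\<bar>H y x' \<theta>' - H y x \<theta>\<bar> < e" by linarith
  qed
qed

lemma H_bounds:
  assumes "x \<in> X" "\<And>l. \<theta> l \<in> mspace (\<Theta> l)"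
  shows "0 \<le> H y x \<theta>" "H y x \<theta> \<le> 1"
  using orthant_monotoneD(1,4)[OF H_orthant_monotone[OF assms]] by auto

text \<open>The construction at a fixed stage \<open>n\<close>. Besides the deterministic error
  \<open>e\<close> there is an error \<open>\<omega> l\<close> for each level, the softmax weight
  that misses the correct step. It can be close to 1 near a jump and is small only after
  integration.\<close>

lemma mmoe_approximation:
  fixes F0 :: "real^'k \<Rightarrow> 'psi \<Rightarrow> real" and \<Phi> :: "'l \<Rightarrow> real measure" and p :: "'l \<Rightarrow> nat \<Rightarrow> real"
  assumes F0_df: "\<And>\<psi>. \<psi> \<in> \<Psi>0 \<Longrightarrow> distribution_function (\<lambda>y. F0 y \<psi>)"
    and F0_dense: "\<And>q :: real^'k. \<exists>\<psi> :: nat \<Rightarrow> 'psi. (\<forall>n. \<psi> n \<in> \<Psi>0) \<and>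
          weak_conv_vec (\<lambda>n y. F0 y (\<psi> n)) (orthant_cdf (return borel q))"
    and \<Phi>: "\<And>l. real_distribution (\<Phi> l)" "\<And>l. continuous_on UNIV (cdf (\<Phi> l))"
    and a: "\<And>i. a i \<in> X" and d: "\<And>l j. d l j \<in> mspace (\<Theta> l)"
    and p: "\<And>l j. 0 \<le> p l j" "\<And>l. (\<Sum>j\<le>n. p l j) = 1" and e: "0 < e"
  shows "\<exists>F J \<omega>. F \<in> mmoe_dfs F0 \<Psi>0 \<and>
    (\<forall>l. J l \<in> measurable (\<Phi> l) (count_space UNIV) \<and> (\<forall>w. J l w \<le> n) \<and>
      (\<forall>j\<le>n. measure (\<Phi> l) {w. J l w = j} = p l j) \<and>
      \<omega> l \<in> borel_measurable (\<Phi> l) \<and> (\<forall>w. 0 \<le> \<omega> l w \<and> \<omega> l w \<le> 1) \<and> (\<integral>w. \<omega> l w \<partial>\<Phi> l) < e) \<and>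
    (\<forall>y x w. \<bar>F y x w - (\<Sum>i\<le>n. soft_voronoi a n i x * H y (a i) (\<lambda>l. d l (J l (w $ l))))\<bar>
       \<le> e + (\<Sum>l\<in>UNIV. \<omega> l (w $ l)))"
proof -
  have "\<forall>l. \<exists>J s r. J \<in> measurable (\<Phi> l) (count_space UNIV) \<and> (\<forall>w. J w \<le> n) \<and>
    (\<forall>j\<le>n. measure (\<Phi> l) {w. J w = j} = p l j) \<and>
    (\<integral>w. 1 - exp (s (J w) * w + r (J w)) / (\<Sum>j\<le>n. exp (s j * w + r j)) \<partial>\<Phi> l) < e"
    using affine_softmax_approximates_step_function[OF \<Phi> p(1) p(2) e] by blast
  then obtain J s r where "\<forall>l. J l \<in> measurable (\<Phi> l) (count_space UNIV) \<and> (\<forall>w. J l w \<le> n) \<and>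
    (\<forall>j\<le>n. measure (\<Phi> l) {w. J l w = j} = p l j) \<and>
    (\<integral>w. 1 - exp (s l (J l w) * w + r l (J l w)) / (\<Sum>j\<le>n. exp (s l j * w + r l j)) \<partial>\<Phi> l) < e"
    unfolding choice_iff by (elim exE)
  then have J: "\<And>l. J l \<in> measurable (\<Phi> l) (count_space UNIV)" "\<And>l w. J l w \<le> n"
    "\<And>l j. j \<le> n \<Longrightarrow> measure (\<Phi> l) {w. J l w = j} = p l j"
    "\<And>l. (\<integral>w. 1 - exp (s l (J l w) * w + r l (J l w)) / (\<Sum>j\<le>n. exp (s l j * w + r l j)) \<partial>\<Phi> l) < e"
    by auto
  define \<omega> where "\<omega> l w = 1 - exp (s l (J l w) * w + r l (J l w)) / (\<Sum>j\<le>n. exp (s l j * w + r l j))" for l w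
  have \<omega>: "0 \<le> \<omega> l w" "\<omega> l w \<le> 1" for l w
  proof -
    have "exp (s l (J l w) * w + r l (J l w)) \<le> (\<Sum>j\<le>n. exp (s l j * w + r l j))"
      using J(2) by (intro member_le_sum) auto
    then show "0 \<le> \<omega> l w" "\<omega> l w \<le> 1"
      using sum_exp_pos[of "\<lambda>j. s l j * w + r l j" n] by (auto simp: \<omega>_def)
  qed
  have \<omega>m: "\<omega> l \<in> borel_measurable (\<Phi> l)" for l
  proof -
    interpret real_distribution "\<Phi> l" by (rule \<Phi>)
    note [measurable] = J(1)[of l]
    show ?thesis unfolding \<omega>_def by measurable
  qed
  define B where "B = (Pi\<^sub>E UNIV (\<lambda>_::'l. {..n}))"
  have fB: "finite B" unfolding B_def by (intro finite_PiE) auto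
  define D where "D i b y = H y (a i) (\<lambda>l. d l (b l))" for i b y
  have D01: "0 \<le> D i b y" "D i b y \<le> 1" for i b y
    unfolding D_def using H_bounds[OF a d] by auto
  have "\<forall>i b. \<exists>(C :: (real^'k) set set) q \<psi>. finite C \<and> (\<forall>A\<in>C. 0 < q A \<and> \<psi> A \<in> \<Psi>0) \<and> (\<Sum>A\<in>C. q A) = (1::real) \<and>
     (\<forall>y. \<bar>(\<Sum>A\<in>C. q A * F0 y (\<psi> A)) - D i b y\<bar> < e)"
    unfolding D_def
    by (intro allI approximate_by_expert_mixture[OF F0_df F0_dense _ _ e] H_df H_continuous_in_y a d)
  then obtain C q \<psi> where "\<forall>i b. finite (C i b :: (real^'k) set set) \<and> (\<forall>A\<in>C i b. 0 < q i b A \<and> \<psi> i b A \<in> \<Psi>0) \<and>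
     (\<Sum>A\<in>C i b. q i b A) = (1::real) \<and> (\<forall>y. \<bar>(\<Sum>A\<in>C i b. q i b A * F0 y (\<psi> i b A)) - D i b y\<bar> < e)"
    unfolding choice_iff by (elim exE)
  then have C: "\<And>i b. finite (C i b :: (real^'k) set set)"
    "\<And>i b A. A \<in> C i b \<Longrightarrow> 0 < q i b A" "\<And>i b A. A \<in> C i b \<Longrightarrow> \<psi> i b A \<in> \<Psi>0"
    "\<And>i b. (\<Sum>A\<in>C i b. q i b A) = (1::real)"
    "\<And>i b y. \<bar>(\<Sum>A\<in>C i b. q i b A * F0 y (\<psi> i b A)) - D i b y\<bar> < e"
    by auto
  define I where "I = (SIGMA i:{..n}. SIGMA b:B. C i b)"
  \<comment> \<open>An expert is indexed by a covariate site \<open>i\<close>, a tuple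
    \<open>b\<close> of factor indices and a cell \<open>A\<close> of the mixture at
    \<open>(i, b)\<close>. The three exponents add up, and \<open>ln (q i b A)\<close> turns the
    mixture weight into part of the intercept. Summing over \<open>A\<close> gives 1, so the
    normaliser factors into a sum over sites and a product over levels.\<close>
  define \<alpha>0 where "\<alpha>0 = (\<lambda>(i, b, A). - real n * (a i \<bullet> a i) + (\<Sum>l\<in>UNIV. r l (b l)) + ln (q i b A))"
  define \<alpha> :: "nat \<times> ('l \<Rightarrow> nat) \<times> (real^'k) set \<Rightarrow> real^'p" where "\<alpha> = (\<lambda>(i, b, A). (2 * real n) *\<^sub>R a i)"
  define \<beta> :: "nat \<times> ('l \<Rightarrow> nat) \<times> (real^'k) set \<Rightarrow> real^'l" where "\<beta> = (\<lambda>(i, b, A). \<chi> l. s l (b l))"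
  define \<psi>' where "\<psi>' = (\<lambda>(i, b, A). \<psi> i b A)"
  have fI: "finite I" unfolding I_def using fB C(1) by (intro finite_SigmaI) auto
  have sumI: "(\<Sum>j\<in>I. f j) = (\<Sum>i\<le>n. \<Sum>b\<in>B. \<Sum>A\<in>C i b. f (i, b, A))" for f :: "_ \<Rightarrow> real"
  proof -
    have "(\<Sum>i\<le>n. \<Sum>b\<in>B. \<Sum>A\<in>C i b. f (i, b, A)) = (\<Sum>i\<le>n. \<Sum>(b, A)\<in>Sigma B (C i). f (i, b, A))"
      using fB C(1) by (intro sum.cong refl sum.Sigma) auto
    also have "\<dots> = (\<Sum>(i, b, A)\<in>I. f (i, b, A))"
      unfolding I_def using fB C(1) by (intro sum.Sigma) auto
    finally show ?thesis by (simp add: split_def)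
  qed
  have "(\<Sum>A\<in>C 0 (\<lambda>_. 0). q 0 (\<lambda>_. 0) A) \<noteq> 0" using C(4) by simp
  then have "C 0 (\<lambda>_. 0) \<noteq> {}" by auto
  then obtain A0 where "A0 \<in> C 0 (\<lambda>_. 0)" by blast
  then have "(0, (\<lambda>_. 0), A0) \<in> I" by (auto simp: I_def B_def)
  then have neI: "I \<noteq> {}" by blast
  define F where "F = (\<lambda>y x w. \<Sum>i\<in>I. exp (\<alpha>0 i + \<alpha> i \<bullet> x + \<beta> i \<bullet> w) / (\<Sum>i'\<in>I. exp (\<alpha>0 i' + \<alpha> i' \<bullet> x + \<beta> i' \<bullet> w)) * F0 y (\<psi>' i))"
  have FM: "F \<in> mmoe_dfs F0 \<Psi>0"
    unfolding F_def using fI neI by (rule softmax_mixture_in_mmoe_dfs) (auto simp: I_def \<psi>'_def C(3))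
  have bound: "\<bar>F y x w - (\<Sum>i\<le>n. soft_voronoi a n i x * H y (a i) (\<lambda>l. d l (J l (w $ l))))\<bar>
       \<le> e + (\<Sum>l\<in>UNIV. \<omega> l (w $ l))" for y x w
  proof -
    define E where "E i = exp (real n * (2 * (a i \<bullet> x) - a i \<bullet> a i))" for i
    define v where "v l j = exp (s l j * w $ l + r l j)" for l j
    define V where "V b = (\<Prod>l\<in>UNIV. v l (b l))" for b
    define ZE where "ZE = (\<Sum>i\<le>n. E i)"
    define ZV where "ZV = (\<Prod>l\<in>UNIV. \<Sum>j\<le>n. v l j)"
    have ZE: "0 < ZE" unfolding ZE_def E_def by (rule sum_exp_pos)
    have ZV: "0 < ZV" unfolding ZV_def v_def by (intro prod_pos ballI sum_exp_pos)
    have ZV': "(\<Sum>b\<in>B. V b) = ZV" unfolding ZV_def V_def B_def by (rule prod_sum_PiE[symmetric]) auto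
    have num: "exp (\<alpha>0 (i, b, A) + \<alpha> (i, b, A) \<bullet> x + \<beta> (i, b, A) \<bullet> w) = E i * V b * q i b A" if "A \<in> C i b" for i b A
    proof -
      have "\<beta> (i, b, A) \<bullet> w = (\<Sum>l\<in>UNIV. s l (b l) * w $ l)" by (simp add: \<beta>_def inner_vec_def)
      then have "\<alpha>0 (i, b, A) + \<alpha> (i, b, A) \<bullet> x + \<beta> (i, b, A) \<bullet> w =
        real n * (2 * (a i \<bullet> x) - a i \<bullet> a i) + (\<Sum>l\<in>UNIV. s l (b l) * w $ l + r l (b l)) + ln (q i b A)"
        by (simp add: \<alpha>0_def \<alpha>_def sum.distrib algebra_simps)
      then show ?thesis using C(2)[OF that] by (simp add: exp_add E_def V_def v_def exp_sum)
    qed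
    have den: "(\<Sum>i'\<in>I. exp (\<alpha>0 i' + \<alpha> i' \<bullet> x + \<beta> i' \<bullet> w)) = ZE * ZV"
    proof -
      have "(\<Sum>i'\<in>I. exp (\<alpha>0 i' + \<alpha> i' \<bullet> x + \<beta> i' \<bullet> w)) = (\<Sum>i\<le>n. \<Sum>b\<in>B. \<Sum>A\<in>C i b. E i * V b * q i b A)"
        unfolding sumI by (intro sum.cong refl num)
      also have "\<dots> = (\<Sum>i\<le>n. \<Sum>b\<in>B. E i * V b)"
        by (simp add: sum_distrib_left[symmetric] C(4))
      also have "\<dots> = ZE * ZV" by (simp add: sum_product ZE_def ZV'[symmetric])
      finally show ?thesis .
    qed
    define \<sigma> where "\<sigma> i = E i / ZE" for i
    define \<gamma> where "\<gamma> b = V b / ZV" for b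
    have \<sigma>: "soft_voronoi a n i x = \<sigma> i" for i
      by (simp add: soft_voronoi_def \<sigma>_def E_def ZE_def)
    have \<sigma>0: "0 \<le> \<sigma> i" for i using ZE by (simp add: \<sigma>_def E_def)
    have \<sigma>1: "(\<Sum>i\<le>n. \<sigma> i) = 1" using ZE by (simp add: \<sigma>_def sum_divide_distrib[symmetric] ZE_def)
    have \<gamma>0: "0 \<le> \<gamma> b" for b using ZV by (simp add: \<gamma>_def V_def v_def prod_nonneg)
    have \<gamma>1: "(\<Sum>b\<in>B. \<gamma> b) = 1" using ZV by (simp add: \<gamma>_def sum_divide_distrib[symmetric] ZV')
    define Mix where "Mix i b = (\<Sum>A\<in>C i b. q i b A * F0 y (\<psi> i b A))" for i b
    have F: "F y x w = (\<Sum>i\<le>n. \<sigma> i * (\<Sum>b\<in>B. \<gamma> b * Mix i b))"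
    proof -
      have "F y x w = (\<Sum>i\<le>n. \<Sum>b\<in>B. \<Sum>A\<in>C i b. E i * V b * q i b A / (ZE * ZV) * F0 y (\<psi> i b A))"
        unfolding F_def den unfolding sumI by (intro sum.cong refl) (simp add: num \<psi>'_def)
      also have "\<dots> = (\<Sum>i\<le>n. \<sigma> i * (\<Sum>b\<in>B. \<gamma> b * Mix i b))"
        unfolding \<sigma>_def \<gamma>_def Mix_def sum_distrib_left by (intro sum.cong refl) simp
      finally show ?thesis .
    qed
    define b0 where "b0 l = J l (w $ l)" for l
    have b0: "b0 \<in> B" using J(2) by (auto simp: B_def b0_def)
    have H0: "H y (a i) (\<lambda>l. d l (J l (w $ l))) = D i b0 y" for i by (simp add: D_def b0_def)
    have inner: "\<bar>(\<Sum>b\<in>B. \<gamma> b * Mix i b) - D i b0 y\<bar> \<le> e + (1 - \<gamma> b0)" for i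
    proof -
      have "(\<Sum>b\<in>B. \<gamma> b * Mix i b) - D i b0 y = (\<Sum>b\<in>B. \<gamma> b * (Mix i b - D i b0 y))"
        using \<gamma>1 by (simp add: right_diff_distrib sum_subtractf sum_distrib_right[symmetric])
      also have "\<bar>\<dots>\<bar> \<le> (\<Sum>b\<in>B. \<bar>\<gamma> b * (Mix i b - D i b0 y)\<bar>)" by (rule sum_abs)
      \<comment> \<open>The correct tuple \<open>b0\<close> costs \<open>e\<close>; any other tuple
        costs at most \<open>e + 1\<close>, as all values of \<open>D\<close> lie in [0, 1]. The
        subtracted term removes the surplus 1 at \<open>b0\<close>.\<close>
      also have "\<dots> \<le> (\<Sum>b\<in>B. \<gamma> b * (e + 1) - (if b = b0 then \<gamma> b else 0))"
      proof (rule sum_mono)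
        fix b assume "b \<in> B"
        have m: "\<bar>Mix i b - D i b y\<bar> < e" using C(5)[of i b y] by (simp add: Mix_def)
        show "\<bar>\<gamma> b * (Mix i b - D i b0 y)\<bar> \<le> \<gamma> b * (e + 1) - (if b = b0 then \<gamma> b else 0)"
        proof (cases "b = b0")
          case True
          have "\<gamma> b * \<bar>Mix i b - D i b0 y\<bar> \<le> \<gamma> b * e" using m True \<gamma>0 by (intro mult_left_mono) auto
          then show ?thesis using True unfolding abs_mult abs_of_nonneg[OF \<gamma>0] by (simp add: distrib_left)
        next
          case False
          have "\<bar>Mix i b - D i b0 y\<bar> \<le> e + 1" using m D01[of i b y] D01[of i b0 y] by linarith
          then have "\<gamma> b * \<bar>Mix i b - D i b0 y\<bar> \<le> \<gamma> b * (e + 1)" using \<gamma>0 by (intro mult_left_mono) auto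
          then show ?thesis using False unfolding abs_mult abs_of_nonneg[OF \<gamma>0] by simp
        qed
      qed
      also have "\<dots> = e + (1 - \<gamma> b0)"
        using \<gamma>1 b0 fB by (simp add: sum_subtractf sum_distrib_right[symmetric])
      finally show ?thesis .
    qed
    have "\<bar>F y x w - (\<Sum>i\<le>n. \<sigma> i * D i b0 y)\<bar> = \<bar>\<Sum>i\<le>n. \<sigma> i * ((\<Sum>b\<in>B. \<gamma> b * Mix i b) - D i b0 y)\<bar>"
      unfolding F by (simp add: right_diff_distrib sum_subtractf)
    also have "\<dots> \<le> (\<Sum>i\<le>n. \<bar>\<sigma> i * ((\<Sum>b\<in>B. \<gamma> b * Mix i b) - D i b0 y)\<bar>)" by (rule sum_abs)
    also have "\<dots> \<le> (\<Sum>i\<le>n. \<sigma> i * (e + (1 - \<gamma> b0)))"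
      using inner \<sigma>0 by (intro sum_mono) (auto simp: abs_mult intro: mult_left_mono)
    also have "\<dots> = e + (1 - \<gamma> b0)" using \<sigma>1 by (simp add: sum_distrib_right[symmetric])
    also have "1 - \<gamma> b0 \<le> (\<Sum>l\<in>UNIV. \<omega> l (w $ l))"
    proof -
      have \<gamma>b0: "\<gamma> b0 = (\<Prod>l\<in>UNIV. 1 - \<omega> l (w $ l))"
        by (simp add: \<gamma>_def V_def ZV_def v_def b0_def \<omega>_def prod_dividef)
      have "1 - \<gamma> b0 \<le> (\<Sum>l\<in>UNIV. 1 - (1 - \<omega> l (w $ l)))"
        unfolding \<gamma>b0 using \<omega> by (intro one_minus_prod_le_sum) auto
      then show ?thesis by simp
    qed
    finally show ?thesis unfolding \<sigma> H0 by simp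
  qed
  show ?thesis
    using FM J(1-3) J(4)[folded \<omega>_def] \<omega> \<omega>m bound
    by (intro exI[of _ F] exI[of _ J] exI[of _ \<omega>]) auto
qed

text \<open>Sites within \<delta> of \<open>x n\<close> contribute at most \<open>e / 2\<close> by
  \<open>uniform_on_compact\<close>, and the remaining ones add less than \<open>e / 2\<close>
  through their total weight. The arguments \<open>y n\<close> and \<open>x n\<close> move with
  \<open>n\<close> while \<theta> is fixed, as dominated convergence over the factors
  requires.\<close>

lemma voronoi_average_tendsto:
  assumes K: "compact K" "K \<subseteq> X" and a: "\<And>i. a i \<in> X" "X \<subseteq> closure (range a)"
    and d: "\<And>l i. d l i \<in> mspace (\<Theta> l)" "\<And>l. mspace (\<Theta> l) \<subseteq> mtopology_of (\<Theta> l) closure_of (range (d l))"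
    and \<theta>: "\<And>l. \<theta> l \<in> mspace (\<Theta> l)" and x: "\<And>n. x n \<in> K"
  shows "(\<lambda>n. (\<Sum>i\<le>n. soft_voronoi a n i (x n) * H (y n) (a i) (\<lambda>l. d l (nearest (\<Theta> l) (d l) n (\<theta> l))))
      - H (y n) (x n) \<theta>) \<longlonglongrightarrow> 0"
proof (rule LIMSEQ_I)
  fix e :: real assume "0 < e"
  define e' where "e' = e / 2"
  have e': "0 < e'" using \<open>0 < e\<close> by (simp add: e'_def)
  obtain \<delta> where \<delta>: "0 < \<delta>"
    "\<And>x x' \<theta>' y. x \<in> K \<Longrightarrow> x' \<in> X \<Longrightarrow> dist x' x < \<delta> \<Longrightarrow> (\<And>l. \<theta>' l \<in> mspace (\<Theta> l)) \<Longrightarrow>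
       (\<And>l. mdist (\<Theta> l) (\<theta> l) (\<theta>' l) < \<delta>) \<Longrightarrow> \<bar>H y x' \<theta>' - H y x \<theta>\<bar> < e'"
    using uniform_on_compact[OF K \<theta> e'] by blast
  have "eventually (\<lambda>n. \<forall>l\<in>UNIV. mdist (\<Theta> l) (d l (nearest (\<Theta> l) (d l) n (\<theta> l))) (\<theta> l) < \<delta>) sequentially"
    by (intro eventually_ball_finite ballI nearest_eventually_close d \<theta> \<delta>(1)) auto
  moreover have "eventually (\<lambda>n. \<forall>x\<in>K. (\<Sum>i\<in>{i\<in>{..n}. \<delta> \<le> dist (a i) x}. soft_voronoi a n i x) < e') sequentially"
    using K a(2) by (intro soft_voronoi_concentrates \<delta>(1) e') auto
  ultimately have "eventually (\<lambda>n. norm ((\<Sum>i\<le>n. soft_voronoi a n i (x n) * H (y n) (a i) (\<lambda>l. d l (nearest (\<Theta> l) (d l) n (\<theta> l))))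
      - H (y n) (x n) \<theta> - 0) < e) sequentially"
  proof eventually_elim
    case (elim n)
    define \<theta>' where "\<theta>' = (\<lambda>l. d l (nearest (\<Theta> l) (d l) n (\<theta> l)))"
    define \<sigma> where "\<sigma> i = soft_voronoi a n i (x n)" for i
    have \<theta>': "\<theta>' l \<in> mspace (\<Theta> l)" "mdist (\<Theta> l) (\<theta> l) (\<theta>' l) < \<delta>" for l
      using elim(1) d(1) by (auto simp: \<theta>'_def mdist_commute)
    have \<sigma>: "0 \<le> \<sigma> i" for i by (simp add: \<sigma>_def soft_voronoi_nonneg)
    have \<sigma>1: "(\<Sum>i\<le>n. \<sigma> i) = 1" by (simp add: \<sigma>_def sum_soft_voronoi)
    have xX: "x n \<in> X" using x K by blast
    have "(\<Sum>i\<le>n. \<sigma> i * H (y n) (a i) \<theta>') - H (y n) (x n) \<theta> = (\<Sum>i\<le>n. \<sigma> i * (H (y n) (a i) \<theta>' - H (y n) (x n) \<theta>))"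
      using \<sigma>1 by (simp add: right_diff_distrib sum_subtractf sum_distrib_right[symmetric])
    also have "\<bar>\<dots>\<bar> \<le> (\<Sum>i\<le>n. \<bar>\<sigma> i * (H (y n) (a i) \<theta>' - H (y n) (x n) \<theta>)\<bar>)" by (rule sum_abs)
    also have "\<dots> \<le> (\<Sum>i\<le>n. \<sigma> i * e' + (if \<delta> \<le> dist (a i) (x n) then \<sigma> i else 0))"
    proof (rule sum_mono)
      fix i
      show "\<bar>\<sigma> i * (H (y n) (a i) \<theta>' - H (y n) (x n) \<theta>)\<bar> \<le> \<sigma> i * e' + (if \<delta> \<le> dist (a i) (x n) then \<sigma> i else 0)"
      proof (cases "\<delta> \<le> dist (a i) (x n)")
        case True
        have "\<bar>H (y n) (a i) \<theta>' - H (y n) (x n) \<theta>\<bar> \<le> e' + 1"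
          using H_bounds[of "a i" \<theta>' "y n", OF a(1) \<theta>'(1)] H_bounds[of "x n" \<theta> "y n", OF xX \<theta>] e' by linarith
        then have "\<sigma> i * \<bar>H (y n) (a i) \<theta>' - H (y n) (x n) \<theta>\<bar> \<le> \<sigma> i * (e' + 1)"
          using \<sigma> by (rule mult_left_mono)
        then show ?thesis using True unfolding abs_mult abs_of_nonneg[OF \<sigma>] by (simp add: distrib_left)
      next
        case False
        then have "\<bar>H (y n) (a i) \<theta>' - H (y n) (x n) \<theta>\<bar> < e'"
          using \<delta>(2)[OF x a(1) _ \<theta>'] by simp
        then have "\<sigma> i * \<bar>H (y n) (a i) \<theta>' - H (y n) (x n) \<theta>\<bar> \<le> \<sigma> i * e'"
          using \<sigma> by (intro mult_left_mono) auto
        then show ?thesis using False unfolding abs_mult abs_of_nonneg[OF \<sigma>] by simp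
      qed
    qed
    also have "\<dots> = e' + (\<Sum>i\<in>{i\<in>{..n}. \<delta> \<le> dist (a i) (x n)}. \<sigma> i)"
      using \<sigma>1 by (simp add: sum.distrib sum_distrib_right[symmetric] sum.inter_filter[of "{..n}", simplified])
    also have "\<dots> < e" using elim(2) x[of n] by (auto simp: \<sigma>_def e'_def)
    finally show ?case by (simp add: \<sigma>_def \<theta>'_def)
  qed
  then show "\<exists>no. \<forall>n\<ge>no. norm ((\<Sum>i\<le>n. soft_voronoi a n i (x n) * H (y n) (a i) (\<lambda>l. d l (nearest (\<Theta> l) (d l) n (\<theta> l))))
      - H (y n) (x n) \<theta> - 0) < e"
    unfolding eventually_sequentially .
qed

text \<open>Continuity refers to the product topology, measurability to the product sigma-algebra.
  The two are reconciled by writing the function as a pointwise limit of its values at nearest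
  points, which depend on \<open>t\<close> only through a tuple of indices.\<close>

lemma H_measurable:
  fixes d :: "'l \<Rightarrow> nat \<Rightarrow> 'a"
  assumes G: "\<And>l. sets (G l) = sets (borel_of_metric (\<Theta> l))"
    and d: "\<And>l i. d l i \<in> mspace (\<Theta> l)" "\<And>l. mspace (\<Theta> l) \<subseteq> mtopology_of (\<Theta> l) closure_of (range (d l))"
    and h: "\<And>l. h l \<in> measurable Q (G l)" and x: "x \<in> X"
  shows "(\<lambda>t. H y x (\<lambda>l. h l t)) \<in> borel_measurable Q"
proof (rule borel_measurable_LIMSEQ_real)
  have hs: "h l t \<in> mspace (\<Theta> l)" if "t \<in> space Q" for l t
    using measurable_space[OF h that, of l] sets_eq_imp_space_eq[OF G, of l] by (simp add: space_borel_of_metric)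
  show "(\<lambda>n. H y x (\<lambda>l. d l (nearest (\<Theta> l) (d l) n (h l t)))) \<longlonglongrightarrow> H y x (\<lambda>l. h l t)" if t: "t \<in> space Q" for t
  proof (rule LIMSEQ_I)
    fix e :: real assume "0 < e"
    obtain \<delta> where \<delta>: "0 < \<delta>"
      "\<And>x' \<theta>' y. x' \<in> X \<Longrightarrow> dist x' x < \<delta> \<Longrightarrow> (\<And>l. \<theta>' l \<in> mspace (\<Theta> l)) \<Longrightarrow>
       (\<And>l. mdist (\<Theta> l) (h l t) (\<theta>' l) < \<delta>) \<Longrightarrow> \<bar>H y x' \<theta>' - H y x (\<lambda>l. h l t)\<bar> < e"
      using uniform_in_y[OF x hs[OF t] \<open>0 < e\<close>] by blast
    have "eventually (\<lambda>n. \<forall>l\<in>UNIV. mdist (\<Theta> l) (d l (nearest (\<Theta> l) (d l) n (h l t))) (h l t) < \<delta>) sequentially"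
      by (intro eventually_ball_finite ballI nearest_eventually_close d hs[OF t] \<delta>(1)) auto
    then have "eventually (\<lambda>n. norm (H y x (\<lambda>l. d l (nearest (\<Theta> l) (d l) n (h l t))) - H y x (\<lambda>l. h l t)) < e) sequentially"
    proof eventually_elim
      case (elim n)
      show ?case unfolding real_norm_def using elim d(1) \<delta>(1) x
        by (intro \<delta>(2)) (auto simp: mdist_commute)
    qed
    then show "\<exists>no. \<forall>n\<ge>no. norm (H y x (\<lambda>l. d l (nearest (\<Theta> l) (d l) n (h l t))) - H y x (\<lambda>l. h l t)) < e"
      unfolding eventually_sequentially .
  qed
  fix n
  have "(\<lambda>t l. nearest (\<Theta> l) (d l) n (h l t)) \<in> measurable Q (count_space UNIV)"
    by (intro measurable_finite_tuple measurable_compose[OF h] measurable_nearest[OF G] d)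
  then show "(\<lambda>t. H y x (\<lambda>l. d l (nearest (\<Theta> l) (d l) n (h l t)))) \<in> borel_measurable Q"
    by (rule measurable_compose[where g = "\<lambda>b. H y x (\<lambda>l. d l (b l))"]) simp
qed

text \<open>The sequence \<open>F\<close> is chosen before \<open>N\<close>, \<open>S\<close>,
  \<open>c\<close> and \<open>K\<close> are fixed, from \<open>\<Phi>\<close>, \<open>G\<close>,
  \<open>H\<close> and the dense sequences alone.\<close>

lemma mmoe_sequence_converges:
  fixes F0 :: "real^'k \<Rightarrow> 'psi \<Rightarrow> real" and \<Phi> :: "'l \<Rightarrow> real measure" and G :: "'l \<Rightarrow> 'a measure"
  assumes F0_df: "\<And>\<psi>. \<psi> \<in> \<Psi>0 \<Longrightarrow> distribution_function (\<lambda>y. F0 y \<psi>)"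
    and F0_dense: "\<And>q :: real^'k. \<exists>\<psi> :: nat \<Rightarrow> 'psi. (\<forall>n. \<psi> n \<in> \<Psi>0) \<and>
          weak_conv_vec (\<lambda>n y. F0 y (\<psi> n)) (orthant_cdf (return borel q))"
    and \<Phi>: "\<And>l. real_distribution (\<Phi> l)" "\<And>l. continuous_on UNIV (cdf (\<Phi> l))"
    and G: "\<And>l. prob_space (G l)" "\<And>l. sets (G l) = sets (borel_of_metric (\<Theta> l))"
    and sep: "\<And>l. separable_space (mtopology_of (\<Theta> l))" and X: "X \<noteq> {}"
  shows "\<exists>F. (\<forall>n. F n \<in> mmoe_dfs F0 \<Psi>0) \<and>
    (\<forall>N S c K. (\<forall>l. c l \<in> {1..N} \<rightarrow> {1..S l}) \<and> compact K \<and> K \<subseteq> X \<longrightarrow>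
      uniform_limit {(y, x). \<forall>i\<in>{1..N}. x i \<in> K}
        (\<lambda>n (y, x). joint_df \<Phi> (\<lambda>y x w. F n y x (\<chi> l. w l)) N S c y x) (\<lambda>(y, x). joint_df G H N S c y x) sequentially)"
proof -
  have spG: "space (G l) = mspace (\<Theta> l)" for l
    using sets_eq_imp_space_eq[OF G(2)] by (simp add: space_borel_of_metric)
  have sp\<Phi>: "space (\<Phi> l) = UNIV" for l
  proof -
    interpret real_distribution "\<Phi> l" by (rule \<Phi>)
    show ?thesis by simp
  qed
  have P\<Phi>: "prob_space (\<Phi> l)" for l using \<Phi>(1) by (simp add: real_distribution_def)
  have "\<exists>d :: nat \<Rightarrow> 'a. (\<forall>i. d i \<in> mspace (\<Theta> l)) \<and> mspace (\<Theta> l) \<subseteq> mtopology_of (\<Theta> l) closure_of (range d)" for l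
  proof -
    have "topspace (mtopology_of (\<Theta> l)) \<noteq> {}"
      using prob_space.not_empty[OF G(1), of l] spG[of l] by simp
    then show ?thesis using separable_space_dense_sequence[OF sep, of l] by (metis topspace_mtopology_of)
  qed
  then obtain d :: "'l \<Rightarrow> nat \<Rightarrow> 'a" where d: "\<And>l i. d l i \<in> mspace (\<Theta> l)"
    "\<And>l. mspace (\<Theta> l) \<subseteq> mtopology_of (\<Theta> l) closure_of (range (d l))" by metis
  obtain A where A: "countable A" "A \<subseteq> X" "X \<subseteq> closure A" using separable[of X] by blast
  have "A \<noteq> {}" using A X by auto
  then have rA: "range (from_nat_into A) = A" using A(1) by (simp add: range_from_nat_into)
  define a where "a = from_nat_into A"
  have a: "a i \<in> X" "X \<subseteq> closure (range a)" for i
    using A from_nat_into[OF \<open>A \<noteq> {}\<close>] by (auto simp: a_def rA)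
  define NN where "NN n l = nearest (\<Theta> l) (d l) n" for n l
  have NNm: "NN n l \<in> measurable (G l) (count_space UNIV)" for n l
    unfolding NN_def by (rule measurable_nearest[OF G(2) d(1)])
  have NNn: "NN n l \<theta> \<le> n" for n l \<theta> unfolding NN_def by (rule nearest(1))
  \<comment> \<open>The law of the nearest index under \<open>G l\<close>, which the step function
    \<open>J n l\<close> is made to reproduce under \<open>\<Phi> l\<close>.\<close>
  define p where "p n l j = measure (G l) {\<theta>\<in>space (G l). NN n l \<theta> = j}" for n l j
  have p1: "(\<Sum>j\<le>n. p n l j) = 1" for n l
  proof -
    interpret prob_space "G l" by (rule G)
    note [measurable] = NNm
    have "(\<Sum>j\<le>n. p n l j) = prob (\<Union>j\<in>{..n}. {\<theta>\<in>space (G l). NN n l \<theta> = j})"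
      unfolding p_def by (intro finite_measure_finite_Union[symmetric]) (auto simp: disjoint_family_on_def)
    also have "(\<Union>j\<in>{..n}. {\<theta>\<in>space (G l). NN n l \<theta> = j}) = space (G l)" using NNn by auto
    finally show ?thesis by (simp add: prob_space)
  qed
  define \<epsilon> where "\<epsilon> n = 1 / real (Suc n)" for n
  have "\<forall>n. \<exists>F J \<omega>. F \<in> mmoe_dfs F0 \<Psi>0 \<and>
    (\<forall>l. J l \<in> measurable (\<Phi> l) (count_space UNIV) \<and> (\<forall>w. J l w \<le> n) \<and>
      (\<forall>j\<le>n. measure (\<Phi> l) {w. J l w = j} = p n l j) \<and>
      \<omega> l \<in> borel_measurable (\<Phi> l) \<and> (\<forall>w. 0 \<le> \<omega> l w \<and> \<omega> l w \<le> 1) \<and> (\<integral>w. \<omega> l w \<partial>\<Phi> l) < \<epsilon> n) \<and>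
    (\<forall>y x w. \<bar>F y x w - (\<Sum>i\<le>n. soft_voronoi a n i x * H y (a i) (\<lambda>l. d l (J l (w $ l))))\<bar>
       \<le> \<epsilon> n + (\<Sum>l\<in>UNIV. \<omega> l (w $ l)))"
    by (intro allI mmoe_approximation[OF F0_df F0_dense \<Phi> a(1) d(1) _ p1]) (auto simp: p_def \<epsilon>_def)
  then obtain F J \<omega> where "\<forall>n. F n \<in> mmoe_dfs F0 \<Psi>0 \<and>
    (\<forall>l. J n l \<in> measurable (\<Phi> l) (count_space UNIV) \<and> (\<forall>w. J n l w \<le> n) \<and>
      (\<forall>j\<le>n. measure (\<Phi> l) {w. J n l w = j} = p n l j) \<and>
      \<omega> n l \<in> borel_measurable (\<Phi> l) \<and> (\<forall>w. 0 \<le> \<omega> n l w \<and> \<omega> n l w \<le> 1) \<and> (\<integral>w. \<omega> n l w \<partial>\<Phi> l) < \<epsilon> n) \<and>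
    (\<forall>y x w. \<bar>F n y x w - (\<Sum>i\<le>n. soft_voronoi a n i x * H y (a i) (\<lambda>l. d l (J n l (w $ l))))\<bar>
       \<le> \<epsilon> n + (\<Sum>l\<in>UNIV. \<omega> n l (w $ l)))"
    unfolding choice_iff by (elim exE)
  then have F: "\<And>n. F n \<in> mmoe_dfs F0 \<Psi>0"
    and Jm: "\<And>n l. J n l \<in> measurable (\<Phi> l) (count_space UNIV)"
    and Jn: "\<And>n l w. J n l w \<le> n"
    and Jp: "\<And>n l j. j \<le> n \<Longrightarrow> measure (\<Phi> l) {w. J n l w = j} = p n l j"
    and \<omega>m: "\<And>n l. \<omega> n l \<in> borel_measurable (\<Phi> l)"
    and \<omega>01: "\<And>n l w. 0 \<le> \<omega> n l w" "\<And>n l w. \<omega> n l w \<le> 1"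
    and \<omega>i: "\<And>n l. (\<integral>w. \<omega> n l w \<partial>\<Phi> l) < \<epsilon> n"
    and FV: "\<And>n y x w. \<bar>F n y x w - (\<Sum>i\<le>n. soft_voronoi a n i x * H y (a i) (\<lambda>l. d l (J n l (w $ l))))\<bar>
       \<le> \<epsilon> n + (\<Sum>l\<in>UNIV. \<omega> n l (w $ l))"
    by auto
  have law: "measure (\<Phi> l) {w\<in>space (\<Phi> l). J n l w = j} = measure (G l) {\<theta>\<in>space (G l). NN n l \<theta> = j}" for n l j
  proof (cases "j \<le> n")
    case True
    then show ?thesis using Jp[OF True, of l] by (simp add: sp\<Phi> p_def)
  next
    case False
    then have "{w\<in>space (\<Phi> l). J n l w = j} = {}" "{\<theta>\<in>space (G l). NN n l \<theta> = j} = {}"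
      using Jn NNn by auto
    then show ?thesis by (simp only: measure_empty)
  qed
  define V where "V n y x b = (\<Sum>i\<le>n. soft_voronoi a n i x * H y (a i) (\<lambda>l. d l (b l)))" for n y x and b :: "'l \<Rightarrow> nat"
  have V01: "0 \<le> V n y x b" "V n y x b \<le> 1" for n y x b
  proof -
    show "0 \<le> V n y x b" unfolding V_def
      using H_bounds(1)[OF a(1) d(1)] soft_voronoi_nonneg by (intro sum_nonneg mult_nonneg_nonneg) auto
    have "V n y x b \<le> (\<Sum>i\<le>n. soft_voronoi a n i x * 1)" unfolding V_def
      using H_bounds(2)[OF a(1) d(1)] soft_voronoi_nonneg by (intro sum_mono mult_left_mono) auto
    then show "V n y x b \<le> 1" by (simp add: sum_soft_voronoi)
  qed
  show ?thesis
  proof (intro exI[of _ F] conjI allI impI F)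
    fix N :: nat and S :: "'l \<Rightarrow> nat" and c :: "'l \<Rightarrow> nat \<Rightarrow> nat" and K
    assume "(\<forall>l. c l \<in> {1..N} \<rightarrow> {1..S l}) \<and> compact K \<and> K \<subseteq> X"
    then have c: "c l \<in> {1..N} \<rightarrow> {1..S l}" and K: "compact K" "K \<subseteq> X" for l by auto
    define I where "I = (SIGMA l:(UNIV::'l set). {1..S l})"
    define M\<Phi> where "M\<Phi> = (\<lambda>(l, s::nat). \<Phi> l)"
    define MG where "MG = (\<lambda>(l, s::nat). G l)"
    define Q\<Phi> where "Q\<Phi> = PiM I M\<Phi>"
    define QG where "QG = PiM I MG"
    have fI: "finite I" unfolding I_def by (intro finite_SigmaI) auto
    have cI: "(l, c l i) \<in> I" if "i \<in> {1..N}" for l i using c[of l] that by (auto simp: I_def Pi_iff)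
    have PM: "prob_space (M\<Phi> i)" "prob_space (MG i)" for i
      using P\<Phi> G(1) by (auto simp: M\<Phi>_def MG_def split: prod.split)
    interpret Q\<Phi>: prob_space Q\<Phi> unfolding Q\<Phi>_def by (intro prob_space_PiM PM)
    interpret QG: prob_space QG unfolding QG_def by (intro prob_space_PiM PM)
    have comp\<Phi>: "(\<lambda>t. t (l, c l i)) \<in> measurable Q\<Phi> (\<Phi> l)" if "i \<in> {1..N}" for l i
      using measurable_component_singleton[OF cI[OF that, of l], of M\<Phi>] by (simp add: Q\<Phi>_def M\<Phi>_def)
    have compG: "(\<lambda>t. t (l, c l i)) \<in> measurable QG (G l)" if "i \<in> {1..N}" for l i
      using measurable_component_singleton[OF cI[OF that, of l], of MG] by (simp add: QG_def MG_def)
    \<comment> \<open>However the units are shared, a single observation sees the marginal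
      \<open>\<Phi> l\<close> at level \<open>l\<close>. Hence the bound on the mean of
      \<open>\<omega>\<close> applies whatever \<open>S\<close> and \<open>c\<close> are.\<close>
    have int_comp: "(\<integral>t. f (t (l, c l i)) \<partial>Q\<Phi>) = (\<integral>w. f w \<partial>\<Phi> l)"
      if i: "i \<in> {1..N}" and f: "f \<in> borel_measurable (\<Phi> l)" for f :: "real \<Rightarrow> real" and l i
    proof -
      have "distr Q\<Phi> (\<Phi> l) (\<lambda>t. t (l, c l i)) = \<Phi> l"
        using distr_PiM_component[of I M\<Phi> "(l, c l i)"] PM(1) cI[OF i] by (simp add: Q\<Phi>_def M\<Phi>_def)
      then show ?thesis using integral_distr[OF comp\<Phi>[OF i] f] by simp
    qed
    have joint\<Phi>: "joint_df \<Phi> f N S c y x = (\<integral>t. (\<Prod>i\<in>{1..N}. f (y i) (x i) (\<lambda>l. t (l, c l i))) \<partial>Q\<Phi>)" for f :: "real^'k \<Rightarrow> real^'p \<Rightarrow> ('l \<Rightarrow> real) \<Rightarrow> real" and y x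
      by (simp add: joint_df_def Q\<Phi>_def M\<Phi>_def I_def)
    have jointG: "joint_df G H N S c y x = (\<integral>t. (\<Prod>i\<in>{1..N}. H (y i) (x i) (\<lambda>l. t (l, c l i))) \<partial>QG)" for y x
      by (simp add: joint_df_def QG_def MG_def I_def)
    have Fm: "(\<lambda>t. F n y x (\<chi> l. t (l, c l i))) \<in> borel_measurable Q\<Phi>" if "i \<in> {1..N}" for n y x i
    proof (rule measurable_compose[OF _ mmoe_df_bounds(3)[OF F0_df F]])
      have "(\<lambda>t. t (l, c l i)) \<in> borel_measurable Q\<Phi>" for l
      proof -
        interpret real_distribution "\<Phi> l" by (rule \<Phi>)
        show ?thesis using comp\<Phi>[OF that, of l] by (simp add: measurable_def)
      qed
      then show "(\<lambda>t. \<chi> l. t (l, c l i)) \<in> borel_measurable Q\<Phi>" by (rule measurable_vec_lambda)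
    qed
    have VJm: "(\<lambda>t. V n y x (\<lambda>l. J n l (t (l, c l i)))) \<in> borel_measurable Q\<Phi>" if "i \<in> {1..N}" for n y x i
      by (rule measurable_compose[where g = "V n y x", OF measurable_finite_tuple[OF measurable_compose[OF comp\<Phi>[OF that] Jm]]]) simp
    have VNm: "(\<lambda>t. V n y x (\<lambda>l. NN n l (t (l, c l i)))) \<in> borel_measurable QG" if "i \<in> {1..N}" for n y x i
      by (rule measurable_compose[where g = "V n y x", OF measurable_finite_tuple[OF measurable_compose[OF compG[OF that] NNm]]]) simp
    \<comment> \<open>Observations that share a unit read the same coordinate of the index tuple, so
      their dependence is carried over with the joint law of the indices.\<close>
    have transfer: "(\<integral>t. (\<Prod>i\<in>{1..N}. V n (y i) (x i) (\<lambda>l. J n l (t (l, c l i)))) \<partial>Q\<Phi>)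
       = (\<integral>t. (\<Prod>i\<in>{1..N}. V n (y i) (x i) (\<lambda>l. NN n l (t (l, c l i)))) \<partial>QG)" for n y x
    proof -
      define f where "f \<tau> = (\<Prod>i\<in>{1..N}. V n (y i) (x i) (\<lambda>l. \<tau> (l, c l i)))" for \<tau> :: "'l \<times> nat \<Rightarrow> nat"
      have fm: "f \<in> borel_measurable (PiM I (\<lambda>_. count_space UNIV))"
        unfolding f_def
      proof (rule borel_measurable_prod)
        fix i assume i: "i \<in> {1..N}"
        have "(\<lambda>(\<tau> :: 'l \<times> nat \<Rightarrow> nat) l. \<tau> (l, c l i)) \<in> measurable (PiM I (\<lambda>_. count_space UNIV)) (count_space UNIV)"
          by (rule measurable_finite_tuple[where h = "\<lambda>l \<tau>. \<tau> (l, c l i)"]) (rule measurable_component_singleton[OF cI[OF i]])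
        then show "(\<lambda>\<tau>. V n (y i) (x i) (\<lambda>l. \<tau> (l, c l i))) \<in> borel_measurable (PiM I (\<lambda>_. count_space UNIV))"
          by (rule measurable_compose) simp
      qed
      have "(\<integral>t. f (\<lambda>i\<in>I. J n (fst i) (t i)) \<partial>Q\<Phi>) = (\<integral>t. f (\<lambda>i\<in>I. NN n (fst i) (t i)) \<partial>QG)"
        unfolding Q\<Phi>_def QG_def
        using Jm NNm law by (intro integral_PiM_equal_discrete_laws fI PM fm) (auto simp: M\<Phi>_def MG_def split: prod.split)
      moreover have "f (\<lambda>i\<in>I. J n (fst i) (t i)) = (\<Prod>i\<in>{1..N}. V n (y i) (x i) (\<lambda>l. J n l (t (l, c l i))))" for t
        unfolding f_def using cI by (intro prod.cong refl) simp
      moreover have "f (\<lambda>i\<in>I. NN n (fst i) (t i)) = (\<Prod>i\<in>{1..N}. V n (y i) (x i) (\<lambda>l. NN n l (t (l, c l i))))" for t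
        unfolding f_def using cI by (intro prod.cong refl) simp
      ultimately show ?thesis by (simp only:)
    qed
    show "uniform_limit {(y, x). \<forall>i\<in>{1..N}. x i \<in> K}
        (\<lambda>n (y, x). joint_df \<Phi> (\<lambda>y x w. F n y x (\<chi> l. w l)) N S c y x) (\<lambda>(y, x). joint_df G H N S c y x) sequentially"
    proof (rule uniform_limit_sequentiallyI)
      fix z :: "nat \<Rightarrow> (nat \<Rightarrow> real^'k) \<times> (nat \<Rightarrow> real^'p)"
      assume z: "\<And>n. z n \<in> {(y, x). \<forall>i\<in>{1..N}. x i \<in> K}"
      define y where "y n = fst (z n)" for n
      define x where "x n = snd (z n)" for n
      have zyx: "z n = (y n, x n)" for n by (simp add: y_def x_def)
      have xK: "x n i \<in> K" if "i \<in> {1..N}" for n i using z[of n] that by (auto simp: zyx)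
      then have xX: "x n i \<in> X" if "i \<in> {1..N}" for n i using that K by blast
      \<comment> \<open>The model, the model with exact steps, the same with nearest indices under
        \<open>G\<close>, and the target. From \<open>PF\<close> to \<open>PJ\<close> the integrated
        softmax error is paid, \<open>PJ\<close> and \<open>PN\<close> have equal integrals, and
        \<open>PN\<close> approaches \<open>PH\<close> by dominated convergence.\<close>
      define PF where "PF n t = (\<Prod>i\<in>{1..N}. F n (y n i) (x n i) (\<chi> l. t (l, c l i)))" for n t
      define PJ where "PJ n t = (\<Prod>i\<in>{1..N}. V n (y n i) (x n i) (\<lambda>l. J n l (t (l, c l i))))" for n t
      define PN where "PN n t = (\<Prod>i\<in>{1..N}. V n (y n i) (x n i) (\<lambda>l. NN n l (t (l, c l i))))" for n t
      define PH where "PH n t = (\<Prod>i\<in>{1..N}. H (y n i) (x n i) (\<lambda>l. t (l, c l i)))" for n t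
      have PFm: "PF n \<in> borel_measurable Q\<Phi>" for n unfolding PF_def by (intro borel_measurable_prod Fm)
      have PJm: "PJ n \<in> borel_measurable Q\<Phi>" for n unfolding PJ_def by (intro borel_measurable_prod VJm)
      have PNm: "PN n \<in> borel_measurable QG" for n unfolding PN_def by (intro borel_measurable_prod VNm)
      have PHm: "PH n \<in> borel_measurable QG" for n unfolding PH_def
        by (intro borel_measurable_prod H_measurable[OF G(2) d] compG xX)
      have PF01: "0 \<le> PF n t \<and> PF n t \<le> 1" for n t unfolding PF_def
        using mmoe_df_bounds(1,2)[OF F0_df F] by (intro conjI prod_nonneg prod_le_1) auto
      have PJ01: "0 \<le> PJ n t \<and> PJ n t \<le> 1" for n t unfolding PJ_def
        using V01 by (intro conjI prod_nonneg prod_le_1) auto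
      have PN01: "0 \<le> PN n t \<and> PN n t \<le> 1" for n t unfolding PN_def
        using V01 by (intro conjI prod_nonneg prod_le_1) auto
      have tm: "t (l, c l i) \<in> mspace (\<Theta> l)" if "t \<in> space QG" "i \<in> {1..N}" for t l i
        using measurable_space[OF compG[OF that(2), of l] that(1)] by (simp add: spG)
      have Hb: "0 \<le> H (y n i) (x n i) (\<lambda>l. t (l, c l i))" "H (y n i) (x n i) (\<lambda>l. t (l, c l i)) \<le> 1"
        if "t \<in> space QG" "i \<in> {1..N}" for n t i
        using H_bounds[OF xX[OF that(2)] tm[OF that], where y = "y n i"] by auto
      have PH01: "0 \<le> PH n t \<and> PH n t \<le> 1" if "t \<in> space QG" for n t unfolding PH_def
        using Hb[OF that] by (intro conjI prod_nonneg prod_le_1) auto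
      have intF: "integrable Q\<Phi> (PF n)" for n
        using PFm PF01 by (intro Q\<Phi>.integrable_const_bound[of _ 1]) auto
      have intJ: "integrable Q\<Phi> (PJ n)" for n
        using PJm PJ01 by (intro Q\<Phi>.integrable_const_bound[of _ 1]) auto
      have intN: "integrable QG (PN n)" for n
        using PNm PN01 by (intro QG.integrable_const_bound[of _ 1]) auto
      have intH: "integrable QG (PH n)" for n
        using PHm PH01 by (intro QG.integrable_const_bound[of _ 1]) (auto intro!: AE_I2)
      have int\<omega>: "integrable Q\<Phi> (\<lambda>t. \<omega> n l (t (l, c l i)))" if "i \<in> {1..N}" for n l i
        using measurable_compose[OF comp\<Phi>[OF that] \<omega>m] \<omega>01 by (intro Q\<Phi>.integrable_const_bound[of _ 1]) auto
      \<comment> \<open>Each of the \<open>N\<close> observations contributes the deterministic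
        error \<open>\<epsilon> n\<close> and, for each level, a mean softmax error below
        \<open>\<epsilon> n\<close>.\<close>
      have first: "norm ((\<integral>t. PF n t \<partial>Q\<Phi>) - (\<integral>t. PJ n t \<partial>Q\<Phi>)) \<le> real N * (\<epsilon> n + real CARD('l) * \<epsilon> n)" for n
      proof -
        have pw: "norm (PF n t - PJ n t) \<le> (\<Sum>i\<in>{1..N}. \<epsilon> n + (\<Sum>l\<in>UNIV. \<omega> n l (t (l, c l i))))" for t
        proof -
          have "norm (PF n t - PJ n t) \<le> (\<Sum>i\<in>{1..N}. norm (F n (y n i) (x n i) (\<chi> l. t (l, c l i)) - V n (y n i) (x n i) (\<lambda>l. J n l (t (l, c l i)))))"
            unfolding PF_def PJ_def using mmoe_df_bounds(1,2)[OF F0_df F] V01 by (intro norm_prod_diff) auto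
          also have "\<dots> \<le> (\<Sum>i\<in>{1..N}. \<epsilon> n + (\<Sum>l\<in>UNIV. \<omega> n l (t (l, c l i))))"
          proof (rule sum_mono)
            fix i
            show "norm (F n (y n i) (x n i) (\<chi> l. t (l, c l i)) - V n (y n i) (x n i) (\<lambda>l. J n l (t (l, c l i)))) \<le> \<epsilon> n + (\<Sum>l\<in>UNIV. \<omega> n l (t (l, c l i)))"
              using FV[of n "y n i" "x n i" "\<chi> l. t (l, c l i)"] by (simp add: V_def)
          qed
          finally show ?thesis .
        qed
        have "norm ((\<integral>t. PF n t \<partial>Q\<Phi>) - (\<integral>t. PJ n t \<partial>Q\<Phi>)) = norm (\<integral>t. PF n t - PJ n t \<partial>Q\<Phi>)"
          using intF intJ by simp
        also have "\<dots> \<le> (\<integral>t. norm (PF n t - PJ n t) \<partial>Q\<Phi>)" by (rule integral_norm_bound)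
        also have "\<dots> \<le> (\<integral>t. (\<Sum>i\<in>{1..N}. \<epsilon> n + (\<Sum>l\<in>UNIV. \<omega> n l (t (l, c l i)))) \<partial>Q\<Phi>)"
          using intF intJ int\<omega> pw by (intro integral_mono) auto
        also have "\<dots> = (\<Sum>i\<in>{1..N}. \<epsilon> n + (\<Sum>l\<in>UNIV. \<integral>w. \<omega> n l w \<partial>\<Phi> l))"
        proof -
          have "(\<integral>t. (\<Sum>i\<in>{1..N}. \<epsilon> n + (\<Sum>l\<in>UNIV. \<omega> n l (t (l, c l i)))) \<partial>Q\<Phi>)
             = (\<Sum>i\<in>{1..N}. \<integral>t. \<epsilon> n + (\<Sum>l\<in>UNIV. \<omega> n l (t (l, c l i))) \<partial>Q\<Phi>)"
            using int\<omega> by (intro Bochner_Integration.integral_sum) auto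
          also have "\<dots> = (\<Sum>i\<in>{1..N}. \<epsilon> n + (\<Sum>l\<in>UNIV. \<integral>w. \<omega> n l w \<partial>\<Phi> l))"
          proof (intro sum.cong refl)
            fix i assume i: "i \<in> {1..N}"
            have "(\<integral>t. \<epsilon> n + (\<Sum>l\<in>UNIV. \<omega> n l (t (l, c l i))) \<partial>Q\<Phi>) = \<epsilon> n + (\<Sum>l\<in>UNIV. \<integral>t. \<omega> n l (t (l, c l i)) \<partial>Q\<Phi>)"
              using int\<omega>[OF i] by (simp add: Q\<Phi>.prob_space)
            then show "(\<integral>t. \<epsilon> n + (\<Sum>l\<in>UNIV. \<omega> n l (t (l, c l i))) \<partial>Q\<Phi>) = \<epsilon> n + (\<Sum>l\<in>UNIV. \<integral>w. \<omega> n l w \<partial>\<Phi> l)"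
              using int_comp[OF i \<omega>m] by simp
          qed
          finally show ?thesis .
        qed
        also have "\<dots> \<le> (\<Sum>i\<in>{1..N}. \<epsilon> n + (\<Sum>l\<in>(UNIV::'l set). \<epsilon> n))"
          using \<omega>i by (intro sum_mono add_left_mono) (auto intro: less_imp_le)
        also have "\<dots> = real N * (\<epsilon> n + real CARD('l) * \<epsilon> n)" by simp
        finally show ?thesis .
      qed
      have lim1: "(\<lambda>n. (\<integral>t. PF n t \<partial>Q\<Phi>) - (\<integral>t. PJ n t \<partial>Q\<Phi>)) \<longlonglongrightarrow> 0"
      proof (rule Lim_null_comparison)
        show "eventually (\<lambda>n. norm ((\<integral>t. PF n t \<partial>Q\<Phi>) - (\<integral>t. PJ n t \<partial>Q\<Phi>)) \<le> real N * (\<epsilon> n + real CARD('l) * \<epsilon> n)) sequentially"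
          using first by simp
        have "\<epsilon> \<longlonglongrightarrow> 0" unfolding \<epsilon>_def by real_asymp
        then have "(\<lambda>n. real N * (\<epsilon> n + real CARD('l) * \<epsilon> n)) \<longlonglongrightarrow> real N * (0 + real CARD('l) * 0)"
          by (intro tendsto_intros)
        then show "(\<lambda>n. real N * (\<epsilon> n + real CARD('l) * \<epsilon> n)) \<longlonglongrightarrow> 0" by simp
      qed
      have pw: "(\<lambda>n. PN n t - PH n t) \<longlonglongrightarrow> 0" if t: "t \<in> space QG" for t
      proof (rule Lim_null_comparison)
        show "eventually (\<lambda>n. norm (PN n t - PH n t) \<le>
           (\<Sum>i\<in>{1..N}. norm (V n (y n i) (x n i) (\<lambda>l. NN n l (t (l, c l i))) - H (y n i) (x n i) (\<lambda>l. t (l, c l i))))) sequentially"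
          unfolding PN_def PH_def using V01 Hb[OF t] by (intro always_eventually allI norm_prod_diff) auto
        have "(\<lambda>n. \<Sum>i\<in>{1..N}. norm (V n (y n i) (x n i) (\<lambda>l. NN n l (t (l, c l i))) - H (y n i) (x n i) (\<lambda>l. t (l, c l i)))) \<longlonglongrightarrow> (\<Sum>i\<in>{1..N}. 0)"
          unfolding V_def NN_def
          by (intro tendsto_sum tendsto_norm_zero voronoi_average_tendsto[OF K a d tm[OF t] xK])
        then show "(\<lambda>n. \<Sum>i\<in>{1..N}. norm (V n (y n i) (x n i) (\<lambda>l. NN n l (t (l, c l i))) - H (y n i) (x n i) (\<lambda>l. t (l, c l i)))) \<longlonglongrightarrow> 0"
          by simp
      qed
      have "(\<lambda>n. \<integral>t. PN n t - PH n t \<partial>QG) \<longlonglongrightarrow> (\<integral>t. 0 \<partial>QG)"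
      proof (rule integral_dominated_convergence[where w = "\<lambda>_. 1"])
        show "AE t in QG. norm (PN n t - PH n t) \<le> 1" for n
        proof (rule AE_I2)
          fix t assume "t \<in> space QG"
          then show "norm (PN n t - PH n t) \<le> 1" using PN01[of n t] PH01[of t n] by auto
        qed
      qed (use pw PNm PHm in \<open>auto intro!: AE_I2\<close>)
      then have lim2: "(\<lambda>n. (\<integral>t. PN n t \<partial>QG) - (\<integral>t. PH n t \<partial>QG)) \<longlonglongrightarrow> 0"
        using intN intH by simp
      have "(\<integral>t. PJ n t \<partial>Q\<Phi>) = (\<integral>t. PN n t \<partial>QG)" for n
        unfolding PJ_def PN_def by (rule transfer)
      then have "(\<lambda>n. (\<integral>t. PF n t \<partial>Q\<Phi>) - (\<integral>t. PH n t \<partial>QG)) \<longlonglongrightarrow> 0"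
        using tendsto_add[OF lim1 lim2] by simp
      then show "(\<lambda>n. (case z n of (y, x) \<Rightarrow> joint_df \<Phi> (\<lambda>y x w. F n y x (\<chi> l. w l)) N S c y x)
          - (case z n of (y, x) \<Rightarrow> joint_df G H N S c y x)) \<longlonglongrightarrow> 0"
        by (simp add: zyx joint\<Phi> jointG PF_def PH_def)
    qed
  qed
qed

end

text \<open>Serves the case of an empty covariate set, where only \<open>N = 0\<close> leaves
  anything to compare: the product of no factors integrates to 1.\<close>

lemma joint_df_no_observations:
  assumes "\<And>l. prob_space (G l)"
  shows "joint_df G H 0 S c y x = 1"
proof -
  interpret prob_space "\<Pi>\<^sub>M (l, s)\<in>(SIGMA l:UNIV. {1..S l}). G l"
    using assms by (intro prob_space_PiM) (auto split: prod.split)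
  show ?thesis using prob_space by (simp add: joint_df_def)
qed

theorem theorem1:
  fixes X :: "(real^'p) set"
    and F0 :: "real^'k \<Rightarrow> 'psi \<Rightarrow> real"
    and \<Psi>0 :: "'psi set"
    and \<Phi> :: "'l::finite \<Rightarrow> real measure"
  assumes F0_df: "\<And>\<psi>. \<psi> \<in> \<Psi>0 \<Longrightarrow> distribution_function (\<lambda>y. F0 y \<psi>)"
    and \<Phi>_prob: "\<And>l. real_distribution (\<Phi> l)"
    and F0_dense: "\<And>q :: real^'k. \<exists>\<psi> :: nat \<Rightarrow> 'psi. (\<forall>n. \<psi> n \<in> \<Psi>0) \<and>
          weak_conv_vec (\<lambda>n y. F0 y (\<psi> n)) (orthant_cdf (return borel q))"
    and \<Phi>_cont: "\<And>l. continuous_on UNIV (cdf (\<Phi> l))"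
  shows "compactly_dense X
           (mmoe_models F0 \<Psi>0 \<Phi> :: ('l, real^'k, real^'p) model set)
           (gen_models TYPE('a) X)"
  unfolding compactly_dense_def
proof
  fix T :: "('l, real^'k, real^'p) model" assume "T \<in> gen_models TYPE('a) X"
  then obtain G H and \<Theta> :: "'l \<Rightarrow> 'a metric" where T: "T = joint_df G H"
    and sep: "\<And>l. separable_space (mtopology_of (\<Theta> l))"
    and G: "\<And>l. prob_space (G l)" "\<And>l. sets (G l) = sets (borel_of_metric (\<Theta> l))"
    and H: "\<And>x \<theta>. x \<in> X \<Longrightarrow> \<theta> \<in> (\<Pi> l\<in>UNIV. mspace (\<Theta> l)) \<Longrightarrow> distribution_function (\<lambda>y. H y x \<theta>)"
      "continuous_map
       (prod_topology euclidean
         (prod_topology (top_of_set X) (product_topology (\<lambda>l. mtopology_of (\<Theta> l)) UNIV)))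
       euclideanreal (\<lambda>(y, x, \<theta>). H y x \<theta>)"
    unfolding gen_models_def by blast
  interpret mixed_effects_kernel X \<Theta> H
    by unfold_locales (auto intro: H)
  show "\<exists>A :: nat \<Rightarrow> ('l, real^'k, real^'p) model. (\<forall>n. A n \<in> mmoe_models F0 \<Psi>0 \<Phi>) \<and>
       (\<forall>N S c Xbar. (\<forall>l. c l \<in> {1..N} \<rightarrow> {1..S l}) \<and> compact Xbar \<and> Xbar \<subseteq> X \<longrightarrow>
         uniform_limit {(y, x). \<forall>i\<in>{1..N}. x i \<in> Xbar}
           (\<lambda>n (y, x). A n N S c y x) (\<lambda>(y, x). T N S c y x) sequentially)"
  \<comment> \<open>An empty \<open>X\<close> offers no covariate sites. Any constant sequence then
    works: for \<open>N\<close> positive no arguments are admissible, and for \<open>N = 0\<close>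
    both joint distribution functions are 1.\<close>
  proof (cases "X = {}")
    case False
    obtain F where F: "\<And>n. F n \<in> mmoe_dfs F0 \<Psi>0"
      "\<forall>N S c K. (\<forall>l. c l \<in> {1..N} \<rightarrow> {1..S l}) \<and> compact K \<and> K \<subseteq> X \<longrightarrow>
      uniform_limit {(y, x). \<forall>i\<in>{1..N}. x i \<in> K}
        (\<lambda>n (y, x). joint_df \<Phi> (\<lambda>y x w. F n y x (\<chi> l. w l)) N S c y x) (\<lambda>(y, x). joint_df G H N S c y x) sequentially"
      using mmoe_sequence_converges[where \<Phi> = \<Phi> and G = G, OF F0_df F0_dense \<Phi>_prob \<Phi>_cont G sep False] by blast
    show ?thesis
    proof (intro exI[of _ "\<lambda>n. joint_df \<Phi> (\<lambda>y x w. F n y x (\<chi> l. w l))"] conjI allI impI)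
      show "joint_df \<Phi> (\<lambda>y x w. F n y x (\<chi> l. w l)) \<in> mmoe_models F0 \<Psi>0 \<Phi>" for n
        unfolding mmoe_models_def using F(1) by blast
    qed (use F(2) in \<open>auto simp: T\<close>)
  next
    case True
    obtain \<psi> where "\<psi> \<in> \<Psi>0" using F0_dense[of 0] by blast
    then obtain F :: "real^'k \<Rightarrow> real^'p \<Rightarrow> real^'l \<Rightarrow> real" where F: "F \<in> mmoe_dfs F0 \<Psi>0"
      using softmax_mixture_in_mmoe_dfs[of "{()}" "\<lambda>_. \<psi>" \<Psi>0] by blast
    define A where "A = joint_df \<Phi> (\<lambda>y x w. F y x (\<chi> l. w l))"
    have "A \<in> mmoe_models F0 \<Psi>0 \<Phi>" unfolding mmoe_models_def A_def using F by blast
    moreover have "uniform_limit {(y, x). \<forall>i\<in>{1..N}. x i \<in> Xbar} (\<lambda>n (y, x). A N S c y x) (\<lambda>(y, x). T N S c y x) sequentially"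
      if "Xbar \<subseteq> X" for N S c Xbar
    proof (cases "N = 0")
      case True
      have "A 0 S c y x = 1" "T 0 S c y x = 1" for y x
        unfolding A_def T using G(1) \<Phi>_prob by (auto intro!: joint_df_no_observations simp: real_distribution_def)
      then show ?thesis using True by (simp add: uniform_limit_const)
    next
      case False
      then have empty: "{(y :: nat \<Rightarrow> real^'k, x). \<forall>i\<in>{1..N}. x i \<in> Xbar} = {}"
        using that \<open>X = {}\<close> by fastforce
      show ?thesis unfolding empty by (simp add: uniform_limit_iff)
    qed
    ultimately show ?thesis by (intro exI[of _ "\<lambda>_. A"]) auto
  qed
qed

end
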